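(* Let $V$ be a VOA over $\mathbb{Q}$, and let $N\le \mathrm{Aut}(V)$ be a finite group containing a normal subgroup $E\cong(\mathbb{Z}/2)^r$ with $r\ge 2$, such that $N$ acts (by conjugation) transitively on the nontrivial linear characters of $E$. Let $D\le E$ with $\mathrm{rank}(E/D)\ge1$, and let $W=V^D$ be the fixed-point subVOA. Suppose $W$ has a finitely generated integral form $K$ which is nearly lattice integral. Then: (i) every integral form $J$ in $V$ contains a finitely generated integral form $J'$ which is nearly lattice integral; (ii) if moreover $G$ is a finite subgroup of $\mathrm{Aut}(V)$ and $J$ is $G$-invariant, then $J'$ may be chosen to be $G$-invariant and to satisfy $J'\cap\mathbb{Q}\mathbf{1}=J\cap\mathbb{Q}\mathbf{1}$ and $J'\cap\mathbb{Q}\omega=J\cap\mathbb{Q}\omega$.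
   Context: $V$ carries its natural (nondegenerate invariant) bilinear form $\langle\ ,\ \rangle$; $\mathbf{1}$ is the vacuum and $\omega$ the conformal vector. An integral form (IF) in a VOA is an additive subgroup which is the $\mathbb{Z}$-span of a $\mathbb{Q}$-basis, closed under all products $a_kb$ ($k\in\mathbb{Z}$), and containing a positive integer multiple of $\mathbf{1}$ and of $\omega$. An IF is finitely generated if it is the smallest additive subgroup closed under all products containing some finite set. An additive subgroup $A$ is lattice integral if $\langle A,A\rangle\subseteq\mathbb{Z}$ and nearly lattice integral if $mA$ is lattice integral for some integer $m>0$. *)

theory Defs
  imports Complex_Main
begin

text \<open>A VOA over Q is given by: a Q-vector space (carrier type 'v with scalar
multiplication sc), the products Y a n b  (= a_n b, n an integer), the vacuum vac,
the conformal vector om, and the grading subspaces grade n (= V_n).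
The axioms are the standard ones (Borcherds / Frenkel-Lepowsky-Meurman):
bilinearity, truncation, vacuum axioms, Borcherds identity, the Z-grading by
finite-dimensional subspaces bounded below, and the conformal vector axioms.\<close>

definition vacuum_axioms ::
  "('v::ab_group_add \<Rightarrow> int \<Rightarrow> 'v \<Rightarrow> 'v) \<Rightarrow> 'v \<Rightarrow> bool" where
  "vacuum_axioms Y vac \<longleftrightarrow>
     (\<forall>a n. Y vac n a = (if n = -1 then a else 0)) \<and>
     (\<forall>a. Y a (-1) vac = a) \<and>
     (\<forall>a n. n \<ge> 0 \<longrightarrow> Y a n vac = 0)"

text \<open>Borcherds identity, for all integers p q r:
  sum_{i>=0} (p choose i) (a_{r+i} b)_{p+q-i} c
   = sum_{i>=0} (-1)^i (r choose i) (a_{p+r-i} b_{q+i} c - (-1)^r b_{q+r-i} a_{p+i} c).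
Both sums are finite by truncation; we sum over i < M for any M beyond which all
the terms vanish.\<close>

definition borcherds_identity ::
  "(rat \<Rightarrow> 'v::ab_group_add \<Rightarrow> 'v) \<Rightarrow> ('v \<Rightarrow> int \<Rightarrow> 'v \<Rightarrow> 'v) \<Rightarrow> bool" where
  "borcherds_identity sc Y \<longleftrightarrow>
     (\<forall>a b c p q r M.
        (\<forall>i\<ge>M. Y a (r + int i) b = 0 \<and> Y b (q + int i) c = 0 \<and> Y a (p + int i) c = 0) \<longrightarrow>
        (\<Sum>i<M. sc (of_int p gchoose i) (Y (Y a (r + int i) b) (p + q - int i) c))
        = (\<Sum>i<M. sc ((-1) ^ i * (of_int r gchoose i))
              (Y a (p + r - int i) (Y b (q + int i) c)
               - sc (if even r then 1 else -1) (Y b (q + r - int i) (Y a (p + int i) c)))))"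

definition is_VOA ::
  "(rat \<Rightarrow> 'v::ab_group_add \<Rightarrow> 'v) \<Rightarrow> ('v \<Rightarrow> int \<Rightarrow> 'v \<Rightarrow> 'v) \<Rightarrow> 'v \<Rightarrow> 'v
    \<Rightarrow> (int \<Rightarrow> 'v set) \<Rightarrow> bool" where
  "is_VOA sc Y vac om grade \<longleftrightarrow>
     vector_space sc \<and>
     \<comment> \<open>bilinearity of all products\<close>
     (\<forall>a b c n. Y (a + b) n c = Y a n c + Y b n c \<and> Y a n (b + c) = Y a n b + Y a n c) \<and>
     (\<forall>q a b n. Y (sc q a) n b = sc q (Y a n b) \<and> Y a n (sc q b) = sc q (Y a n b)) \<and>
     \<comment> \<open>truncation\<close>
     (\<forall>a b. \<exists>N. \<forall>n\<ge>N. Y a n b = 0) \<and>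
     vacuum_axioms Y vac \<and>
     borcherds_identity sc Y \<and>
     \<comment> \<open>grading: V is the direct sum of the finite-dimensional subspaces V_n\<close>
     (\<forall>n. module.subspace sc (grade n)) \<and>
     (\<forall>n. \<exists>B. finite B \<and> B \<subseteq> grade n \<and> grade n \<subseteq> module.span sc B) \<and>
     (\<forall>v. \<exists>!f. finite {n. f n \<noteq> 0} \<and> (\<forall>n. f n \<in> grade n) \<and> v = sum f {n. f n \<noteq> 0}) \<and>
     (\<exists>N. \<forall>n<N. grade n = {0}) \<and>
     (\<forall>a b m n k. a \<in> grade m \<longrightarrow> b \<in> grade n \<longrightarrow> Y a k b \<in> grade (m + n - k - 1)) \<and>
     vac \<in> grade 0 \<and> om \<in> grade 2 \<and>
     \<comment> \<open>conformal vector: L(n) = om_{n+1}\<close>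
     (\<forall>n v. v \<in> grade n \<longrightarrow> Y om 1 v = sc (of_int n) v) \<and>
     (\<forall>a n b. Y (Y om 0 a) n b = sc (- of_int n) (Y a (n - 1) b)) \<and>
     (\<exists>c::rat. \<forall>m n v.
        Y om (m + 1) (Y om (n + 1) v) - Y om (n + 1) (Y om (m + 1) v)
        = sc (of_int (m - n)) (Y om (m + n + 1) v)
          + (if m + n = 0 then sc ((of_int m ^ 3 - of_int m) / 12 * c) v else 0))"

text \<open>The natural invariant bilinear form: bilinear, nondegenerate, normalised by
<vac,vac> = 1, and invariant:
  <Y(a,z)b, c> = <b, Y(e^{zL(1)}(-z^{-2})^{L(0)} a, z^{-1}) c>,
which in components, for a in V_k, reads
  <a_n b, c> = (-1)^k sum_{j>=0} (1/j!) <b, (L(1)^j a)_{2k-n-j-2} c>.\<close>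

definition natural_form ::
  "(rat \<Rightarrow> 'v::ab_group_add \<Rightarrow> 'v) \<Rightarrow> ('v \<Rightarrow> int \<Rightarrow> 'v \<Rightarrow> 'v) \<Rightarrow> 'v \<Rightarrow> 'v
    \<Rightarrow> (int \<Rightarrow> 'v set) \<Rightarrow> ('v \<Rightarrow> 'v \<Rightarrow> rat) \<Rightarrow> bool" where
  "natural_form sc Y vac om grade form \<longleftrightarrow>
     (\<forall>a b c. form (a + b) c = form a c + form b c \<and> form a (b + c) = form a b + form a c) \<and>
     (\<forall>q a b. form (sc q a) b = q * form a b \<and> form a (sc q b) = q * form a b) \<and>
     (\<forall>a. (\<forall>b. form a b = 0) \<longrightarrow> a = 0) \<and>
     (\<forall>b. (\<forall>a. form a b = 0) \<longrightarrow> b = 0) \<and>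
     form vac vac = 1 \<and>
     (\<forall>k a b c n M. a \<in> grade k \<longrightarrow> (\<forall>j\<ge>M. (Y om 2 ^^ j) a = 0) \<longrightarrow>
        form (Y a n b) c
        = (if even k then 1 else -1) *
          (\<Sum>j<M. form b (Y ((Y om 2 ^^ j) a) (2 * k - n - int j - 2) c) / fact j))"

definition VOA_aut ::
  "(rat \<Rightarrow> 'v::ab_group_add \<Rightarrow> 'v) \<Rightarrow> ('v \<Rightarrow> int \<Rightarrow> 'v \<Rightarrow> 'v) \<Rightarrow> 'v \<Rightarrow> 'v
    \<Rightarrow> ('v \<Rightarrow> 'v) \<Rightarrow> bool" where
  "VOA_aut sc Y vac om g \<longleftrightarrow>
     bij g \<and> (\<forall>a b. g (a + b) = g a + g b) \<and> (\<forall>q a. g (sc q a) = sc q (g a)) \<and>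
     (\<forall>a n b. g (Y a n b) = Y (g a) n (g b)) \<and> g vac = vac \<and> g om = om"

definition is_subgroup :: "('v \<Rightarrow> 'v) set \<Rightarrow> ('v \<Rightarrow> 'v) set \<Rightarrow> bool" where
  "is_subgroup H G \<longleftrightarrow> H \<subseteq> G \<and> id \<in> H \<and> (\<forall>g\<in>H. \<forall>h\<in>H. g \<circ> h \<in> H) \<and> (\<forall>g\<in>H. inv g \<in> H)"

definition finite_aut_group ::
  "(rat \<Rightarrow> 'v::ab_group_add \<Rightarrow> 'v) \<Rightarrow> ('v \<Rightarrow> int \<Rightarrow> 'v \<Rightarrow> 'v) \<Rightarrow> 'v \<Rightarrow> 'v
    \<Rightarrow> ('v \<Rightarrow> 'v) set \<Rightarrow> bool" where
  "finite_aut_group sc Y vac om G \<longleftrightarrow>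
     finite G \<and> is_subgroup G {g. VOA_aut sc Y vac om g}"

definition normal_subgroup :: "('v \<Rightarrow> 'v) set \<Rightarrow> ('v \<Rightarrow> 'v) set \<Rightarrow> bool" where
  "normal_subgroup E N \<longleftrightarrow> is_subgroup E N \<and> (\<forall>g\<in>N. \<forall>e\<in>E. g \<circ> e \<circ> inv g \<in> E)"

text \<open>E is isomorphic to (Z/2)^r; (Z/2)^r is modelled as the functions nat => bool
supported on {0..<r} with pointwise exclusive or.\<close>
definition iso_Z2_power :: "('v \<Rightarrow> 'v) set \<Rightarrow> nat \<Rightarrow> bool" where
  "iso_Z2_power E r \<longleftrightarrow>
     (\<exists>\<phi>. bij_betw \<phi> E {f :: nat \<Rightarrow> bool. \<forall>i\<ge>r. \<not> f i} \<and>
          (\<forall>e\<in>E. \<forall>e'\<in>E. \<phi> (e \<circ> e') = (\<lambda>i. \<phi> e i \<noteq> \<phi> e' i)))"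

definition linear_char :: "('v \<Rightarrow> 'v) set \<Rightarrow> (('v \<Rightarrow> 'v) \<Rightarrow> complex) \<Rightarrow> bool" where
  "linear_char E \<chi> \<longleftrightarrow> (\<forall>e\<in>E. \<chi> e \<noteq> 0) \<and> (\<forall>e\<in>E. \<forall>e'\<in>E. \<chi> (e \<circ> e') = \<chi> e * \<chi> e')"

definition nontrivial_char :: "('v \<Rightarrow> 'v) set \<Rightarrow> (('v \<Rightarrow> 'v) \<Rightarrow> complex) \<Rightarrow> bool" where
  "nontrivial_char E \<chi> \<longleftrightarrow> linear_char E \<chi> \<and> (\<exists>e\<in>E. \<chi> e \<noteq> 1)"

definition transitive_on_nontrivial_chars :: "('v \<Rightarrow> 'v) set \<Rightarrow> ('v \<Rightarrow> 'v) set \<Rightarrow> bool" where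
  "transitive_on_nontrivial_chars N E \<longleftrightarrow>
     (\<forall>\<chi> \<psi>. nontrivial_char E \<chi> \<longrightarrow> nontrivial_char E \<psi> \<longrightarrow>
        (\<exists>g\<in>N. \<forall>e\<in>E. \<psi> e = \<chi> (inv g \<circ> e \<circ> g)))"

definition fixed_points :: "('v \<Rightarrow> 'v) set \<Rightarrow> 'v set" where
  "fixed_points D = {v. \<forall>d\<in>D. d v = v}"

definition zspan :: "(rat \<Rightarrow> 'v::ab_group_add \<Rightarrow> 'v) \<Rightarrow> 'v set \<Rightarrow> 'v set" where
  "zspan sc B = {(\<Sum>b\<in>F. sc (of_int (c b)) b) | F c. finite F \<and> F \<subseteq> B}"

definition additive_subgroup :: "'v::ab_group_add set \<Rightarrow> bool" where
  "additive_subgroup A \<longleftrightarrow> 0 \<in> A \<and> (\<forall>a\<in>A. \<forall>b\<in>A. a + b \<in> A) \<and> (\<forall>a\<in>A. - a \<in> A)"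

definition product_closed :: "('v \<Rightarrow> int \<Rightarrow> 'v \<Rightarrow> 'v) \<Rightarrow> 'v set \<Rightarrow> bool" where
  "product_closed Y A \<longleftrightarrow> (\<forall>a\<in>A. \<forall>b\<in>A. \<forall>k. Y a k b \<in> A)"

definition integral_form ::
  "(rat \<Rightarrow> 'v::ab_group_add \<Rightarrow> 'v) \<Rightarrow> ('v \<Rightarrow> int \<Rightarrow> 'v \<Rightarrow> 'v) \<Rightarrow> 'v \<Rightarrow> 'v
    \<Rightarrow> 'v set \<Rightarrow> 'v set \<Rightarrow> bool" where
  "integral_form sc Y vac om S A \<longleftrightarrow>
     A \<subseteq> S \<and> additive_subgroup A \<and>
     (\<exists>B. \<not> module.dependent sc B \<and> module.span sc B = S \<and> A = zspan sc B) \<and>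
     product_closed Y A \<and>
     (\<exists>m::nat. m > 0 \<and> sc (of_nat m) vac \<in> A) \<and>
     (\<exists>m::nat. m > 0 \<and> sc (of_nat m) om \<in> A)"

definition generated_closure :: "('v::ab_group_add \<Rightarrow> int \<Rightarrow> 'v \<Rightarrow> 'v) \<Rightarrow> 'v set \<Rightarrow> 'v set" where
  "generated_closure Y F = \<Inter>{X. F \<subseteq> X \<and> additive_subgroup X \<and> product_closed Y X}"

definition finitely_generated :: "('v::ab_group_add \<Rightarrow> int \<Rightarrow> 'v \<Rightarrow> 'v) \<Rightarrow> 'v set \<Rightarrow> bool" where
  "finitely_generated Y A \<longleftrightarrow> (\<exists>F. finite F \<and> A = generated_closure Y F)"

definition lattice_integral :: "('v \<Rightarrow> 'v \<Rightarrow> rat) \<Rightarrow> 'v set \<Rightarrow> bool" where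
  "lattice_integral form A \<longleftrightarrow> (\<forall>a\<in>A. \<forall>b\<in>A. form a b \<in> \<int>)"

definition nearly_lattice_integral ::
  "(rat \<Rightarrow> 'v \<Rightarrow> 'v) \<Rightarrow> ('v \<Rightarrow> 'v \<Rightarrow> rat) \<Rightarrow> 'v set \<Rightarrow> bool" where
  "nearly_lattice_integral sc form A \<longleftrightarrow>
     (\<exists>m::nat. m > 0 \<and> lattice_integral form (sc (of_nat m) ` A))"

end

theory Submission
  imports Defs
begin

text \<open>By transitivity on characters, \<open>V\<close> is spanned by the translates of \<open>W\<close> under \<open>N\<close>, so the
  translates of generators of \<open>K\<close> generate \<open>V\<close> as an algebra over the rationals. Replace them by
  positive multiples \<open>f\<close> of their homogeneous components such that \<open>L(1)\<^sup>j f / j!\<close> lies in \<open>J\<close> for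
  all \<open>j\<close>, add bases of \<open>J \<inter> \<rat>vac\<close> and \<open>J \<inter> \<rat>om\<close>, and close up under \<open>G\<close>. The subring
  \<open>J'\<close> generated by this finite set lies in \<open>J\<close> and spans \<open>V\<close>; it is an integral form because a
  subgroup of a free abelian group is free. The adjoints of the generating operators preserve the
  graded part of \<open>J\<close>, so the form on \<open>J'\<close> reduces to pairings of the vacuum with the lattice
  \<open>J \<inter> V\<^sub>0\<close> of finite rank, whose values have bounded denominators.\<close>

section \<open>Integer spans and additive subgroups of a rational vector space\<close>

locale rat_vector_space = vector_space sc
  for sc :: "rat \<Rightarrow> 'v::ab_group_add \<Rightarrow> 'v"
begin

lemma additive_subgroup_scale_int:
  assumes A: "additive_subgroup A" and a: "a \<in> A"
  shows "sc (of_int k) a \<in> A"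
proof -
  have nat: "sc (of_nat n) a \<in> A" for n :: nat
    using A a by (induction n) (auto simp: additive_subgroup_def scale_left_distrib)
  show ?thesis
  proof (cases "k \<ge> 0")
    case True
    then show ?thesis using nat[of "nat k"] by simp
  next
    case False
    then have "sc (of_int k) a = - sc (of_nat (nat (- k))) a"
      by (simp flip: scale_minus_left)
    then show ?thesis using nat A by (simp add: additive_subgroup_def)
  qed
qed

lemma additive_subgroup_sum:
  assumes A: "additive_subgroup A" and f: "\<And>i. i \<in> I \<Longrightarrow> f i \<in> A"
  shows "sum f I \<in> A"
proof (cases "finite I")
  case True
  then show ?thesis using f
    by (induction I rule: finite_induct) (use A in \<open>auto simp: additive_subgroup_def\<close>)
next
  case False
  then show ?thesis using A by (simp add: additive_subgroup_def)
qed

lemma additive_subgroup_diff: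
  "additive_subgroup A \<Longrightarrow> a \<in> A \<Longrightarrow> b \<in> A \<Longrightarrow> a - b \<in> A"
  unfolding additive_subgroup_def by (metis diff_conv_add_uminus)

lemma zspan_least:
  assumes "S \<subseteq> A" "additive_subgroup A"
  shows "zspan sc S \<subseteq> A"
  using assms by (auto simp: zspan_def intro!: additive_subgroup_sum additive_subgroup_scale_int)

lemma zspan_base: "S \<subseteq> zspan sc S"
proof
  fix x assume "x \<in> S"
  then show "x \<in> zspan sc S"
    unfolding zspan_def by (intro CollectI exI[of _ "{x}"] exI[of _ "\<lambda>_. 1"]) auto
qed

lemma additive_subgroup_zspan: "additive_subgroup (zspan sc S)"
  unfolding additive_subgroup_def
proof (intro conjI ballI)
  show "0 \<in> zspan sc S"
    unfolding zspan_def by (intro CollectI exI[of _ "{}"]) auto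
next
  fix a b assume "a \<in> zspan sc S" "b \<in> zspan sc S"
  then obtain F c F' c' where F: "finite F" "F \<subseteq> S" "a = (\<Sum>b\<in>F. sc (of_int (c b)) b)"
    and F': "finite F'" "F' \<subseteq> S" "b = (\<Sum>b\<in>F'. sc (of_int (c' b)) b)"
    unfolding zspan_def by blast
  \<comment> \<open>Extended by zero, both coefficient families live on the common support
    \<open>F \<union> F'\<close> and can be added there.\<close>
  let ?d = "\<lambda>x. if x \<in> F then c x else 0" and ?d' = "\<lambda>x. if x \<in> F' then c' x else 0"
  have "a = (\<Sum>b\<in>F \<union> F'. sc (of_int (?d b)) b)" "b = (\<Sum>b\<in>F \<union> F'. sc (of_int (?d' b)) b)"
    unfolding F F' using F(1) F'(1) by (auto intro!: sum.mono_neutral_cong_left)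
  then have "a + b = (\<Sum>b\<in>F \<union> F'. sc (of_int (?d b + ?d' b)) b)"
    by (simp only: sum.distrib[symmetric] scale_left_distrib[symmetric] of_int_add)
  then show "a + b \<in> zspan sc S"
    unfolding zspan_def using F F'
    by (intro CollectI exI[of _ "F \<union> F'"] exI[of _ "\<lambda>b. ?d b + ?d' b"]) auto
next
  fix a assume "a \<in> zspan sc S"
  then obtain F c where F: "finite F" "F \<subseteq> S" "a = (\<Sum>b\<in>F. sc (of_int (c b)) b)"
    unfolding zspan_def by blast
  then have "- a = (\<Sum>b\<in>F. sc (of_int (- c b)) b)"
    by (simp add: sum_negf)
  then show "- a \<in> zspan sc S"
    unfolding zspan_def using F
    by (intro CollectI exI[of _ F] exI[of _ "\<lambda>b. - c b"]) auto
qed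

lemma zspan_subset_span: "zspan sc S \<subseteq> span S"
  by (auto simp: zspan_def intro!: span_sum span_scale intro: span_base)

lemma span_zspan: "span (zspan sc S) = span S"
  by (meson span_eq zspan_subset_span zspan_base span_superset order_trans)

lemma subspace_imp_additive_subgroup: "subspace U \<Longrightarrow> additive_subgroup U"
  by (simp add: additive_subgroup_def subspace_0 subspace_add subspace_neg)

text \<open>Denominators are cleared one summand at a time, so \<open>S\<close> may be infinite or
  linearly dependent.\<close>

lemma zspan_multiple:
  assumes "v \<in> span S"
  obtains m :: nat where "m > 0" "sc (of_nat m) v \<in> zspan sc S"
proof -
  from assms have "\<exists>m::nat. m > 0 \<and> sc (of_nat m) v \<in> zspan sc S"
  proof (induction rule: span_induct_alt)
    case base
    then show ?case
      by (intro exI[of _ 1]) (use additive_subgroup_zspan in \<open>auto simp: additive_subgroup_def\<close>)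
  next
    case (step c x y)
    then obtain m :: nat where m: "m > 0" "sc (of_nat m) y \<in> zspan sc S" by blast
    obtain p q where q: "quotient_of c = (p, q)" "q > 0"
      by (metis surj_pair quotient_of_denom_pos)
    then have c: "c = of_int p / of_int q" by (simp add: quotient_of_div)
    have 1: "of_nat (m * nat q) = of_int q * (of_nat m :: rat)" using q by simp
    have 2: "of_int q * (of_nat m :: rat) * c = of_int (int m * p)" using q c by simp
    have "sc (of_nat (m * nat q)) (sc c x + y)
        = sc (of_int (int m * p)) x + sc (of_int q) (sc (of_nat m) y)"
      unfolding scale_right_distrib scale_scale 1 2 ..
    moreover have "\<dots> \<in> zspan sc S"
      using additive_subgroup_zspan[of S] zspan_base[of S] step(1) m(2)
        additive_subgroup_scale_int[OF additive_subgroup_zspan]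
      unfolding additive_subgroup_def by blast
    ultimately show ?case using m(1) q(2)
      by (intro exI[of _ "m * nat q"]) simp
  qed
  then show thesis using that by blast
qed

section \<open>Subgroups of free abelian groups of arbitrary rank\<close>

lemma representation_zspan_Ints:
  assumes "independent B" "v \<in> zspan sc B"
  shows "representation B v b \<in> \<int>"
proof -
  \<comment> \<open>The vectors with integral \<open>b\<close>-coordinate form an additive subgroup
    containing \<open>B\<close>.\<close>
  have "zspan sc B \<subseteq> {v \<in> span B. representation B v b \<in> \<int>}"
    using assms(1)
    by (intro zspan_least)
       (auto simp: additive_subgroup_def span_base representation_basis span_zero
          representation_zero representation_add representation_neg span_add span_neg)
  then show ?thesis using assms(2) by blast
qed

text \<open>Well-order the basis. Among the elements of the subgroup whose leading basis vector is
  \<^term>\<open>b\<close>, pick one with least positive leading coefficient; these form a basis of the subgroup.\<close>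

lemma subgroup_of_free_is_free:
  assumes ind: "independent B" and A: "additive_subgroup A" and AB: "A \<subseteq> zspan sc B"
  obtains C where "independent C" "A = zspan sc C"
proof -
  define R where "R = representation B"
  obtain r :: "'v rel" where r: "well_order_on UNIV r" using well_order_on by blast
  define lt where "lt = r - Id"
  have wf: "wf lt" and tot: "\<And>x y. x = y \<or> (x, y) \<in> lt \<or> (y, x) \<in> lt"
    and tr: "trans lt"
    using r unfolding lt_def well_order_on_def linear_order_on_def partial_order_on_def
      preorder_on_def total_on_def by (auto intro: trans_diff_Id)
  have irr: "(x, x) \<notin> lt" for x by (simp add: lt_def)
  have asym: "(x, y) \<in> lt \<Longrightarrow> (y, x) \<notin> lt" for x y
    using tr irr unfolding trans_def by blast
  have max_ex: "\<exists>m\<in>T. \<forall>x\<in>T. x = m \<or> (x, m) \<in> lt" if T: "finite T" "T \<noteq> {}" for T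
  proof -
    have "asymp_on T (\<lambda>x y. (x, y) \<in> lt)" using asym by (auto simp: asymp_on_def)
    moreover have "transp_on T (\<lambda>x y. (x, y) \<in> lt)"
      using tr unfolding transp_on_def trans_def by blast
    ultimately obtain m where "m \<in> T" "\<forall>x\<in>T. x \<noteq> m \<longrightarrow> (m, x) \<notin> lt"
      using Finite_Set.bex_max_element[OF T(1) _ _ T(2)] by blast
    then show ?thesis using tot by blast
  qed
  have sp: "A \<subseteq> span B" using AB zspan_subset_span by blast
  \<comment> \<open>\<open>S b\<close> holds the elements of \<open>A\<close> supported at or below
    \<open>b\<close>, including those in which \<open>b\<close> does not occur. For a good
    \<open>b\<close> some element really has \<open>b\<close> as its leading basis vector.\<close>
  define S where "S b = {v\<in>A. \<forall>c. R v c \<noteq> 0 \<longrightarrow> c = b \<or> (c, b) \<in> lt}" for b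
  define good where "good b \<longleftrightarrow> (\<exists>v\<in>S b. R v b \<noteq> 0)" for b
  have SA: "v \<in> S b \<Longrightarrow> v \<in> A" for v b by (simp add: S_def)
  have R_diff: "R (v - sc q w) c = R v c - q * R w c" if "v \<in> A" "w \<in> A" for v w q c
    using that sp ind unfolding R_def
    by (simp add: representation_diff representation_scale span_scale subsetD)
  have S_diff: "v - sc (of_int k) w \<in> S b" if "v \<in> S b" "w \<in> S b" for v w k b
  proof -
    have "v - sc (of_int k) w \<in> A"
      using that A SA by (auto intro!: additive_subgroup_diff additive_subgroup_scale_int)
    moreover have "R (v - sc (of_int k) w) c \<noteq> 0 \<Longrightarrow> c = b \<or> (c, b) \<in> lt" for c
      using that R_diff[OF SA[OF that(1)] SA[OF that(2)], of "of_int k" c]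
      by (cases "R v c = 0"; cases "R w c = 0") (auto simp: S_def)
    ultimately show ?thesis by (auto simp: S_def)
  qed
  have ints: "\<exists>z::int. R v b = of_int z" if "v \<in> A" for v b
    using representation_zspan_Ints[OF ind, of v b] that AB unfolding R_def Ints_def by auto
  have "\<exists>a\<in>S b. R a b \<noteq> 0 \<and> (\<forall>v\<in>S b. \<exists>k::int. R v b = of_int k * R a b)" if "good b" for b
  proof -
    define P where "P n \<longleftrightarrow> n > 0 \<and> (\<exists>v\<in>S b. R v b = of_nat n)" for n :: nat
    obtain v z where v: "v \<in> S b" "R v b \<noteq> 0" "R v b = of_int z"
      using \<open>good b\<close> ints SA unfolding good_def by metis
    have z0: "0 \<in> S b" using A by (simp add: S_def R_def representation_zero additive_subgroup_def)
    have "P (nat \<bar>z\<bar>)"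
    proof (cases "z > 0")
      case True
      then show ?thesis using v by (auto simp: P_def intro!: bexI[of _ v])
    next
      case False
      have "R (0 - sc (of_int 1) v) b = - of_int z"
        using R_diff[of 0 v 1 b] SA z0 v by (simp add: R_def representation_zero)
      moreover have "z \<noteq> 0" using v by auto
      ultimately show ?thesis using False S_diff[OF z0 v(1), of 1]
        by (auto simp: P_def intro!: bexI[of _ "0 - sc (of_int 1) v"])
    qed
    then have "P (LEAST n. P n)" by (rule LeastI)
    then obtain n a where n: "n = (LEAST n. P n)" "n > 0" "a \<in> S b" "R a b = of_nat n"
      unfolding P_def by blast
    have "\<exists>k::int. R w b = of_int k * R a b" if w: "w \<in> S b" for w
    proof -
      obtain y where y: "R w b = of_int y" using ints SA w by metis
      \<comment> \<open>Division with remainder: the remainder is again the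
        \<open>b\<close>-coordinate of an element of \<open>S b\<close>, so it vanishes by
        minimality of \<open>n\<close>.\<close>
      define u where "u = w - sc (of_int (y div int n)) a"
      have "R u b = of_int (y mod int n)"
        unfolding u_def using R_diff[of w a "of_int (y div int n)" b] SA w n y
        by (simp add: minus_div_mult_eq_mod[symmetric])
      moreover have "u \<in> S b" unfolding u_def using S_diff w n by blast
      moreover have m: "0 \<le> y mod int n" "y mod int n < int n" using n by auto
      ultimately have "y mod int n > 0 \<Longrightarrow> P (nat (y mod int n))"
        by (auto simp: P_def intro!: bexI[of _ u])
      moreover have "\<not> P (nat (y mod int n))"
        using not_less_Least[of "nat (y mod int n)" P] m n(1,2) by linarith
      ultimately have "y mod int n = 0" using m by linarith
      then have "y = (y div int n) * int n" by (metis add.right_neutral div_mult_mod_eq)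
      then have "of_int y = of_int (y div int n) * (of_nat n :: rat)"
        by (metis of_int_mult of_int_of_nat_eq)
      then show ?thesis using y n by auto
    qed
    then show ?thesis using n(2-4) by (intro bexI[of _ a]) auto
  qed
  then obtain a where a: "\<And>b. good b \<Longrightarrow> a b \<in> S b" "\<And>b. good b \<Longrightarrow> R (a b) b \<noteq> 0"
    "\<And>b v. good b \<Longrightarrow> v \<in> S b \<Longrightarrow> \<exists>k::int. R v b = of_int k * R (a b) b"
    by metis
  define C where "C = a ` {b. good b}"
  have CA: "C \<subseteq> A" using a(1) SA unfolding C_def by blast
  have lead: "\<exists>b. v \<in> S b \<and> R v b \<noteq> 0" if v: "v \<in> A" "v \<noteq> 0" for v
  proof -
    have "v = (\<Sum>b | R v b \<noteq> 0. sc (R v b) b)"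
      using sum_nonzero_representation_eq[OF ind, of v] v sp unfolding R_def by auto
    then have "{b. R v b \<noteq> 0} \<noteq> {}" using v(2) by force
    moreover have "finite {b. R v b \<noteq> 0}" unfolding R_def by (rule finite_representation)
    ultimately show ?thesis using max_ex[of "{b. R v b \<noteq> 0}"] v unfolding S_def by blast
  qed
  \<comment> \<open>Well-founded induction on the bound \<open>b\<close>: subtracting an integer
    multiple of \<open>a b\<close> removes the \<open>b\<close>-coordinate, and what remains is zero
    or has a strictly smaller leading vector.\<close>
  have gen: "v \<in> S b \<Longrightarrow> v \<in> zspan sc C" for v b
    using wf
  proof (induction b arbitrary: v rule: wf_induct_rule)
    case (less b)
    obtain w where w: "w \<in> S b" "R w b = 0" "v \<in> zspan sc C \<longleftrightarrow> w \<in> zspan sc C"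
    proof (cases "good b")
      case True
      obtain k :: int where k: "R v b = of_int k * R (a b) b" using a(3) True less by blast
      let ?w = "v - sc (of_int k) (a b)"
      have *: "sc (of_int k) (a b) \<in> zspan sc C"
        using True zspan_base[of C]
        by (intro additive_subgroup_scale_int additive_subgroup_zspan) (auto simp: C_def)
      have "v = ?w + sc (of_int k) (a b)" by simp
      then have "v \<in> zspan sc C \<longleftrightarrow> ?w \<in> zspan sc C"
        using * additive_subgroup_zspan[of C] additive_subgroup_diff
        by (metis additive_subgroup_def)
      moreover have "?w \<in> S b" using S_diff[OF less.prems a(1)[OF True]] .
      moreover have "R ?w b = 0"
        using R_diff[OF SA[OF less.prems] SA[OF a(1)[OF True]]] k by simp
      ultimately show thesis using that by blast
    next
      case False
      then show thesis using that less unfolding good_def by blast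
    qed
    show ?case
    proof (cases "w = 0")
      case True
      then show ?thesis using w additive_subgroup_zspan by (auto simp: additive_subgroup_def)
    next
      case False
      then obtain c where c: "w \<in> S c" "R w c \<noteq> 0" using lead SA w(1) by blast
      moreover have "c = b \<or> (c, b) \<in> lt" using w(1) c(2) by (simp add: S_def)
      then have "(c, b) \<in> lt" using w(2) c(2) by auto
      ultimately show ?thesis using less.IH w(3) by blast
    qed
  qed
  have "A = zspan sc C"
  proof
    show "A \<subseteq> zspan sc C"
      using gen lead additive_subgroup_zspan unfolding additive_subgroup_def by blast
    show "zspan sc C \<subseteq> A" by (rule zspan_least[OF CA A])
  qed
  moreover have "independent C"
  proof
    assume "dependent C"
    then obtain T u where T: "finite T" "T \<subseteq> C" "(\<Sum>v\<in>T. sc (u v) v) = 0" "\<exists>v\<in>T. u v \<noteq> 0"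
      unfolding dependent_explicit by blast
    \<comment> \<open>If \<open>a b = a b'\<close>, then \<open>b\<close> and \<open>b'\<close> are
      both leading vectors of the same element, so each is at or below the other.\<close>
    have inj: "b = b'" if "good b" "good b'" "a b = a b'" for b b'
      using a(1,2)[OF that(1)] a(1,2)[OF that(2)] that(3) asym unfolding S_def by fastforce
    \<comment> \<open>Take the largest leading vector \<open>b\<close> that occurs in the relation
      with nonzero coefficient. All other terms have smaller leading vectors, so the
      \<open>b\<close>-coordinate of the sum is \<open>u (a b) * R (a b) b\<close>, which is
      nonzero.\<close>
    define Q where "Q = {b. good b \<and> a b \<in> T \<and> u (a b) \<noteq> 0}"
    have "inj_on a Q" using inj by (auto simp: inj_on_def Q_def)
    moreover have "a ` Q \<subseteq> T" by (auto simp: Q_def)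
    ultimately have "finite Q" using T(1) by (metis finite_imageD finite_subset)
    moreover have "Q \<noteq> {}" using T(2,4) by (auto simp: Q_def C_def)
    ultimately obtain b where b: "b \<in> Q" "\<forall>x\<in>Q. x = b \<or> (x, b) \<in> lt" using max_ex by blast
    have TB: "v \<in> span B" if "v \<in> T" for v using that T(2) CA sp by blast
    have "0 = R (\<Sum>v\<in>T. sc (u v) v) b" using T(3) by (simp add: R_def representation_zero)
    also have "\<dots> = (\<Sum>v\<in>T. u v * R v b)"
      unfolding R_def using ind TB
      by (simp add: representation_sum representation_scale span_scale)
    also have "\<dots> = (\<Sum>v\<in>{a b}. u v * R v b)"
    proof (rule sum.mono_neutral_right)
      show "\<forall>v\<in>T - {a b}. u v * R v b = 0"
      proof
        fix v assume v: "v \<in> T - {a b}"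
        then obtain c where c: "good c" "v = a c" using T(2) by (auto simp: C_def)
        show "u v * R v b = 0"
        proof (cases "u v = 0")
          case False
          then have "(c, b) \<in> lt" using b v c by (auto simp: Q_def)
          then have "\<not> (b = c \<or> (b, c) \<in> lt)" using asym irr by blast
          then show ?thesis using a(1)[OF c(1)] c(2) unfolding S_def by auto
        qed simp
      qed
    qed (use T b in \<open>auto simp: Q_def\<close>)
    also have "\<dots> \<noteq> 0" using a(2) b by (auto simp: Q_def)
    finally show False by simp
  qed
  ultimately show thesis using that by blast
qed

text \<open>The basis \<open>C\<close> of \<open>A\<close> is independent over the rationals inside
  the span of the finite set \<open>T\<close>, hence finite.\<close>

lemma subgroup_of_free_finite_basis:
  assumes "independent B" "additive_subgroup A" "A \<subseteq> zspan sc B" "A \<subseteq> span T" "finite T"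
  obtains C where "finite C" "A = zspan sc C"
proof -
  obtain C where C: "independent C" "A = zspan sc C"
    using subgroup_of_free_is_free[OF assms(1-3)] by blast
  moreover have "C \<subseteq> span T" using C(2) zspan_base assms(4) by blast
  ultimately show thesis using that independent_span_bound[OF assms(5)] by blast
qed

end

section \<open>Generated subrings, common denominators and integrality of binomial
  coefficients\<close>

lemma generated_closure_superset: "F \<subseteq> generated_closure Y F"
  by (auto simp: generated_closure_def)

lemma additive_subgroup_generated_closure: "additive_subgroup (generated_closure Y F)"
  by (auto simp: generated_closure_def additive_subgroup_def)

lemma product_closed_generated_closure: "product_closed Y (generated_closure Y F)"
  by (auto simp: generated_closure_def product_closed_def)

lemma generated_closure_least:
  "F \<subseteq> X \<Longrightarrow> additive_subgroup X \<Longrightarrow> product_closed Y X \<Longrightarrow> generated_closure Y F \<subseteq> X"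
  by (auto simp: generated_closure_def)

lemma finite_common_multiple_Ints:
  fixes C :: "rat set"
  assumes "finite C"
  obtains m :: nat where "m > 0" "\<And>c. c \<in> C \<Longrightarrow> of_nat m * c \<in> \<int>"
proof -
  from assms have "\<exists>m::nat. m > 0 \<and> (\<forall>c\<in>C. of_nat m * c \<in> \<int>)"
  proof (induction C)
    case (insert c C)
    then obtain m :: nat where m: "m > 0" "\<forall>c\<in>C. of_nat m * c \<in> \<int>" by blast
    obtain p q where q: "quotient_of c = (p, q)" "q > 0"
      by (metis surj_pair quotient_of_denom_pos)
    then have c: "of_int q * c = of_int p" using quotient_of_div[of c p q] by simp
    have 1: "of_nat (nat q * m) * x = of_int q * (of_nat m * x)" for x :: rat
      using q by simp
    have 2: "of_int q * (of_nat m * c) \<in> \<int>"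
      using c by (metis mult.left_commute Ints_mult Ints_of_int Ints_of_nat)
    have "of_nat (nat q * m) * x \<in> \<int>" if "x \<in> insert c C" for x
      unfolding 1 using that m 2 by auto
    then show ?case using m q by (intro exI[of _ "nat q * m"]) auto
  qed auto
  then show thesis using that by blast
qed

text \<open>For a negative upper index, upper negation gives a signed ordinary binomial coefficient.
  This makes the coefficients of the Borcherds identity integers, so that the identity can be used
  inside additive subgroups.\<close>

lemma gbinomial_of_int_Ints: "(of_int k gchoose i :: 'a::field_char_0) \<in> \<int>"
proof (cases "k \<ge> 0")
  case True
  then have "(of_int k gchoose i :: 'a) = of_nat (nat k choose i)"
    by (simp add: binomial_gbinomial)
  then show ?thesis by simp
next
  case False
  then have "of_nat i - of_int k - 1 = (of_nat (nat (int i - k - 1)) :: 'a)"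
    by (simp add: of_nat_nat)
  then have "(of_int k gchoose i :: 'a) = (-1) ^ i * of_nat (nat (int i - k - 1) choose i)"
    by (subst gbinomial_negated_upper) (simp add: binomial_gbinomial)
  then show ?thesis by simp
qed

section \<open>The grading, the operator L(1) and automorphisms of a vertex operator algebra\<close>

locale voa =
  fixes sc :: "rat \<Rightarrow> 'v::ab_group_add \<Rightarrow> 'v"
    and Y :: "'v \<Rightarrow> int \<Rightarrow> 'v \<Rightarrow> 'v"
    and vac om :: 'v
    and grade :: "int \<Rightarrow> 'v set"
  assumes VOA: "is_VOA sc Y vac om grade"

sublocale voa \<subseteq> rat_vector_space sc
  using VOA unfolding is_VOA_def rat_vector_space_def by blast

context voa
begin

abbreviation L1 :: "'v \<Rightarrow> 'v" where "L1 \<equiv> Y om 2"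

lemma Y_add:
  "\<forall>a b c n. Y (a + b) n c = Y a n c + Y b n c \<and> Y a n (b + c) = Y a n b + Y a n c"
  using VOA unfolding is_VOA_def by (elim conjE) assumption

lemma Y_scale:
  "\<forall>q a b n. Y (sc q a) n b = sc q (Y a n b) \<and> Y a n (sc q b) = sc q (Y a n b)"
  using VOA unfolding is_VOA_def by (elim conjE) assumption

lemma Y_truncation [rule_format]:
  "\<forall>a b. \<exists>N. \<forall>n\<ge>N. Y a n b = 0"
  using VOA unfolding is_VOA_def by (elim conjE) assumption

lemma Y_vac_right [rule_format]:
  "\<forall>a. Y a (-1) vac = a"
  using VOA unfolding is_VOA_def vacuum_axioms_def by (elim conjE) assumption

lemma Y_vac_right_nonneg [rule_format]:
  "\<forall>a n. n \<ge> 0 \<longrightarrow> Y a n vac = 0"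
  using VOA unfolding is_VOA_def vacuum_axioms_def by (elim conjE) assumption

lemma borcherds:
  "borcherds_identity sc Y"
  using VOA unfolding is_VOA_def by (elim conjE) assumption

lemma subspace_grade [rule_format]:
  "\<forall>n. subspace (grade n)"
  using VOA unfolding is_VOA_def by (elim conjE) assumption

lemma grade_finite_dim [rule_format]:
  "\<forall>n. \<exists>B. finite B \<and> B \<subseteq> grade n \<and> grade n \<subseteq> span B"
  using VOA unfolding is_VOA_def by (elim conjE) assumption

lemma grade_decomposition:
  "\<forall>v. \<exists>!f. finite {n. f n \<noteq> 0} \<and> (\<forall>n. f n \<in> grade n) \<and> v = sum f {n. f n \<noteq> 0}"
  using VOA unfolding is_VOA_def by (elim conjE) assumption

lemma grade_bounded_below:
  "\<exists>N. \<forall>n<N. grade n = {0}"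
  using VOA unfolding is_VOA_def by (elim conjE) assumption

lemma Y_grade [rule_format]:
  "\<forall>a b m n k. a \<in> grade m \<longrightarrow> b \<in> grade n \<longrightarrow> Y a k b \<in> grade (m + n - k - 1)"
  using VOA unfolding is_VOA_def by (elim conjE) assumption

lemma vac_grade:
  "vac \<in> grade 0"
  using VOA unfolding is_VOA_def by (elim conjE) assumption

lemma om_grade:
  "om \<in> grade 2"
  using VOA unfolding is_VOA_def by (elim conjE) assumption

lemma L0_grade [rule_format]:
  "\<forall>n v. v \<in> grade n \<longrightarrow> Y om 1 v = sc (of_int n) v"
  using VOA unfolding is_VOA_def by (elim conjE) assumption

lemma virasoro:
  "\<exists>c::rat. \<forall>m n v.
        Y om (m + 1) (Y om (n + 1) v) - Y om (n + 1) (Y om (m + 1) v)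
        = sc (of_int (m - n)) (Y om (m + n + 1) v)
          + (if m + n = 0 then sc ((of_int m ^ 3 - of_int m) / 12 * c) v else 0)"
  using VOA unfolding is_VOA_def by (elim conjE) assumption

lemma Y_add_left: "Y (a + b) n c = Y a n c + Y b n c"
  and Y_add_right: "Y a n (b + c) = Y a n b + Y a n c"
  using Y_add by auto

lemma Y_scale_left: "Y (sc q a) n b = sc q (Y a n b)"
  and Y_scale_right: "Y a n (sc q b) = sc q (Y a n b)"
  using Y_scale by auto

lemma Y_zero_left: "Y 0 n b = 0" and Y_zero_right: "Y a n 0 = 0"
  using Y_scale_left[of 0 0 n b] Y_scale_right[of a n 0 0] by auto

lemma Y_minus_left: "Y (- a) n b = - Y a n b" and Y_minus_right: "Y a n (- b) = - Y a n b"
  using Y_scale_left[of "- 1" a n b] Y_scale_right[of a n "- 1" b] by auto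

lemma Y_sum_right: "Y a n (sum f I) = (\<Sum>i\<in>I. Y a n (f i))"
  by (induction I rule: infinite_finite_induct) (auto simp: Y_zero_right Y_add_right)

lemma L1_vac: "L1 vac = 0"
  by (simp add: Y_vac_right_nonneg)

text \<open>Apply [L(1), L(-2)] = 3 L(-1) to the vacuum: L(-2) sends it to \<open>om\<close>, while
  L(1) and L(-1) kill it. The central term is absent because 1 + (-2) is nonzero.\<close>

lemma L1_om: "L1 om = 0"
proof -
  obtain c :: rat where c: "\<forall>m n v.
        Y om (m + 1) (Y om (n + 1) v) - Y om (n + 1) (Y om (m + 1) v)
        = sc (of_int (m - n)) (Y om (m + n + 1) v)
          + (if m + n = 0 then sc ((of_int m ^ 3 - of_int m) / 12 * c) v else 0)"
    using virasoro by blast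
  show ?thesis
    using c[rule_format, of 1 "-2" vac] by (simp add: Y_vac_right Y_vac_right_nonneg Y_zero_right)
qed

lemma L1_pow_zero: "(L1 ^^ j) 0 = 0"
  by (induction j) (auto simp: Y_zero_right)

lemma L1_pow_scale: "(L1 ^^ j) (sc q a) = sc q ((L1 ^^ j) a)"
  by (induction j) (auto simp: Y_scale_right)

lemma L1_pow_grade: "a \<in> grade k \<Longrightarrow> (L1 ^^ j) a \<in> grade (k - int j)"
proof (induction j)
  case (Suc j)
  show ?case using Y_grade[OF om_grade Suc.IH[OF Suc.prems], of 2] by (simp add: algebra_simps)
qed simp

text \<open>L(1) lowers the weight by one and the weights are bounded below. This makes the adjoint
  formula for the form a finite sum.\<close>

lemma L1_nilpotent:
  assumes "a \<in> grade k"
  obtains M where "\<And>j. j \<ge> M \<Longrightarrow> (L1 ^^ j) a = 0"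
proof -
  obtain N where N: "\<And>n. n < N \<Longrightarrow> grade n = {0}" using grade_bounded_below by blast
  show thesis
  proof (rule that)
    fix j assume "j \<ge> nat (k - N + 1)"
    then show "(L1 ^^ j) a = 0" using L1_pow_grade[OF assms, of j] N[of "k - int j"] by auto
  qed
qed

lemma homogeneous_sum_zero:
  assumes "finite S" "\<And>n. n \<in> S \<Longrightarrow> f n \<in> grade n" "sum f S = 0" "n \<in> S"
  shows "f n = 0"
proof -
  define P where
    "P f \<longleftrightarrow> finite {n. f n \<noteq> 0} \<and> (\<forall>n. f n \<in> grade n) \<and> 0 = sum f {n. f n \<noteq> 0}" for f
  \<comment> \<open>Extended by zero, \<open>f\<close> becomes a homogeneous decomposition of 0,
    which is unique.\<close>
  define f' where "f' n = (if n \<in> S then f n else 0)" for n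
  have sub: "{n. f' n \<noteq> 0} \<subseteq> S" by (auto simp: f'_def)
  then have fin: "finite {n. f' n \<noteq> 0}" using assms(1) finite_subset by blast
  have "sum f' {n. f' n \<noteq> 0} = sum f' S"
    using sub assms(1) by (intro sum.mono_neutral_left) auto
  also have "\<dots> = 0" using assms(3) by (simp add: f'_def)
  finally have "P f'" using assms(2) fin subspace_0[OF subspace_grade] by (auto simp: P_def f'_def)
  moreover have "P (\<lambda>_. 0)" using subspace_0[OF subspace_grade] by (auto simp: P_def)
  ultimately have "f' = (\<lambda>_. 0)"
    using grade_decomposition[rule_format, of 0, folded P_def] by blast
  then show ?thesis using assms(4) unfolding f'_def by metis
qed

lemma homogeneous_decomposition:
  obtains S f where "finite S" "\<And>n. f n \<in> grade n" "v = (\<Sum>n\<in>S. f n)"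
  using grade_decomposition[rule_format, of v] by blast

text \<open>Comparing homogeneous components leaves only the one of weight \<open>k\<close>. Thus
  the grading is determined by L(0), hence by \<open>om\<close>.\<close>

lemma L0_eigenspace:
  assumes "Y om 1 v = sc (of_int k) v"
  shows "v \<in> grade k"
proof -
  obtain S f where f: "finite S" "\<And>n. f n \<in> grade n" "v = (\<Sum>n\<in>S. f n)"
    using homogeneous_decomposition[of v] by blast
  have "0 = Y om 1 v - sc (of_int k) v" using assms by simp
  also have "\<dots> = (\<Sum>n\<in>S. sc (of_int (n - k)) (f n))"
    by (simp add: f(3) Y_sum_right L0_grade[OF f(2)] scale_sum_right scale_left_diff_distrib
        sum_subtractf)
  finally have "sc (of_int (n - k)) (f n) = 0" if "n \<in> S" for n
    using homogeneous_sum_zero[OF f(1), of "\<lambda>n. sc (of_int (n - k)) (f n)" n] that f(2)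
    by (simp add: subspace_scale[OF subspace_grade])
  then have "n = k \<or> f n = 0" if "n \<in> S" for n using that by fastforce
  then have "f n \<in> grade k" if "n \<in> S" for n
    using that f(2)[of n] subspace_0[OF subspace_grade, of k] by metis
  then show ?thesis unfolding f(3) by (intro subspace_sum[OF subspace_grade])
qed

text \<open>An automorphism fixes \<open>om\<close>, so it commutes with L(0) and preserves its
  eigenspaces.\<close>

lemma VOA_aut_grade: "VOA_aut sc Y vac om g \<Longrightarrow> v \<in> grade k \<Longrightarrow> g v \<in> grade k"
  unfolding VOA_aut_def by (intro L0_eigenspace) (metis L0_grade)

lemma VOA_aut_L1_pow: "VOA_aut sc Y vac om g \<Longrightarrow> g ((L1 ^^ j) a) = (L1 ^^ j) (g a)"
  unfolding VOA_aut_def by (induction j) auto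

text \<open>In the Borcherds identity with \<open>p = 0\<close> the left side collapses to its first
  term, since 0 choose i vanishes for i > 0. This writes every operator of a product
  \<open>Y a k b\<close>, applied to \<open>c\<close>, as an integer combination of composites of
  operators of \<open>a\<close> and \<open>b\<close>.\<close>

lemma iterate_preserves_subgroup:
  assumes H: "additive_subgroup H"
    and a: "\<And>n x. x \<in> H \<Longrightarrow> Y a n x \<in> H" and b: "\<And>n x. x \<in> H \<Longrightarrow> Y b n x \<in> H"
    and c: "c \<in> H"
  shows "Y (Y a k b) q c \<in> H"
proof -
  obtain N1 N2 N3 where N: "\<forall>n\<ge>N1. Y a n b = 0" "\<forall>n\<ge>N2. Y b n c = 0" "\<forall>n\<ge>N3. Y a n c = 0"
    using Y_truncation by meson
  \<comment> \<open>All three families vanish from index \<open>M\<close> on; the successor keeps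
    index 0, the only surviving term on the left, within range.\<close>
  define M where "M = Suc (nat (max (N1 - k) (max (N2 - q) N3)))"
  have M: "\<forall>i\<ge>M. Y a (k + int i) b = 0 \<and> Y b (q + int i) c = 0 \<and> Y a (0 + int i) c = 0"
    using N unfolding M_def by auto
  let ?t = "\<lambda>i. sc ((-1) ^ i * (of_int k gchoose i))
              (Y a (0 + k - int i) (Y b (q + int i) c)
               - sc (if even k then 1 else -1) (Y b (q + k - int i) (Y a (0 + int i) c)))"
  have "(\<Sum>i<M. sc (of_int 0 gchoose i) (Y (Y a (k + int i) b) (0 + q - int i) c)) = (\<Sum>i<M. ?t i)"
    using borcherds M unfolding borcherds_identity_def by blast
  moreover have "(\<Sum>i<M. sc (of_int 0 gchoose i) (Y (Y a (k + int i) b) (0 + q - int i) c))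
      = (\<Sum>i\<in>{0}. sc (of_int 0 gchoose i) (Y (Y a (k + int i) b) (0 + q - int i) c))"
    by (intro sum.mono_neutral_right) (auto simp: M_def gbinomial_0_left)
  moreover have "?t i \<in> H" for i
  proof -
    have "(-1) ^ i * (of_int k gchoose i) \<in> (\<int> :: rat set)"
      by (intro Ints_mult Ints_power gbinomial_of_int_Ints) auto
    then obtain z where "(-1) ^ i * (of_int k gchoose i) = (of_int z :: rat)"
      by (elim Ints_cases)
    moreover have "sc (if even k then 1 else -1) x \<in> H" if "x \<in> H" for x
      using that H by (auto simp: additive_subgroup_def)
    ultimately show ?thesis
      using additive_subgroup_scale_int[OF H] additive_subgroup_diff[OF H] a b c
      by (simp only: )
  qed
  ultimately show ?thesis using additive_subgroup_sum[OF H, of "{..<M}" ?t] by simp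
qed

section \<open>Integral forms, their subrings and vectors with integral adjoints\<close>

lemma product_closed_zspan:
  assumes "\<And>a b k. a \<in> S \<Longrightarrow> b \<in> S \<Longrightarrow> Y a k b \<in> zspan sc S"
  shows "product_closed Y (zspan sc S)"
proof -
  let ?Z = "zspan sc S"
  have add: "additive_subgroup ?Z" by (rule additive_subgroup_zspan)
  have 1: "?Z \<subseteq> {b. Y a k b \<in> ?Z}" if "a \<in> S" for a k
    using assms that add
    by (intro zspan_least) (auto simp: additive_subgroup_def Y_zero_right Y_add_right Y_minus_right)
  have 2: "?Z \<subseteq> {a. \<forall>b\<in>?Z. \<forall>k. Y a k b \<in> ?Z}"
    using 1 add
    by (intro zspan_least) (auto simp: additive_subgroup_def Y_zero_left Y_add_left Y_minus_left)
  then show ?thesis unfolding product_closed_def by blast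
qed

lemma product_closed_span:
  assumes A: "product_closed Y A"
  shows "product_closed Y (span A)"
proof -
  have 1: "span A \<subseteq> {b. Y a k b \<in> span A}" if "a \<in> A" for a k
    using A that
    by (intro span_minimal)
       (auto simp: subspace_def product_closed_def Y_zero_right Y_add_right Y_scale_right
          span_zero span_add span_scale intro: span_base)
  have 2: "span A \<subseteq> {a. \<forall>b\<in>span A. \<forall>k. Y a k b \<in> span A}"
    using 1
    by (intro span_minimal)
       (auto simp: subspace_def Y_zero_left Y_add_left Y_scale_left span_zero span_add span_scale)
  then show ?thesis unfolding product_closed_def by blast
qed

lemma integral_form_multiple:
  assumes "integral_form sc Y vac om UNIV J"
  obtains m :: nat where "m > 0" "sc (of_nat m) v \<in> J"
  using assms zspan_multiple[of v] unfolding integral_form_def by (metis UNIV_I)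

text \<open>An integral form is free abelian, so its intersection with a finite-dimensional subspace
  is a lattice of finite rank. This is used for the weight 0 space and for the lines through
  \<open>vac\<close> and \<open>om\<close>.\<close>

lemma integral_form_intersect_finite_dim:
  assumes J: "integral_form sc Y vac om UNIV J" and U: "subspace U" "U \<subseteq> span T" "finite T"
  obtains C where "finite C" "J \<inter> U = zspan sc C"
proof -
  obtain B where B: "independent B" "J = zspan sc B" using J unfolding integral_form_def by blast
  have "additive_subgroup (J \<inter> U)"
    using J subspace_imp_additive_subgroup[OF U(1)]
    unfolding integral_form_def additive_subgroup_def by blast
  then show thesis
    using subgroup_of_free_finite_basis[OF B(1), of "J \<inter> U" T] B(2) U that by blast
qed

text \<open>Up to sign, the adjoint of \<open>Y f n\<close> with respect to the invariant form is a
  sum of operators of the vectors L(1)^j f / j!. Requiring these vectors to lie in \<open>J\<close>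
  makes the adjoint preserve \<open>J\<close>.\<close>

definition adjoint_stable :: "'v set \<Rightarrow> 'v set" where
  "adjoint_stable J = {f. (\<exists>k. f \<in> grade k) \<and> (\<forall>j. sc (1 / fact j) ((L1 ^^ j) f) \<in> J)}"

lemma adjoint_stable_subset: "adjoint_stable J \<subseteq> J"
proof
  fix f assume "f \<in> adjoint_stable J"
  then have "sc (1 / fact 0) ((L1 ^^ 0) f) \<in> J" unfolding adjoint_stable_def by blast
  then show "f \<in> J" by simp
qed

lemma adjoint_stable_if_L1_zero:
  assumes "f \<in> J" "f \<in> grade k" "L1 f = 0" "0 \<in> J"
  shows "f \<in> adjoint_stable J"
proof -
  have "sc (1 / fact j) ((L1 ^^ j) f) \<in> J" for j
    using assms by (cases j) (simp_all add: funpow_Suc_right L1_pow_zero del: funpow.simps(2))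
  then show ?thesis using assms(2) unfolding adjoint_stable_def by blast
qed

text \<open>Only finitely many of the vectors L(1)^j f / j! are nonzero, so one common multiple
  moves them all into \<open>J\<close>.\<close>

lemma adjoint_stable_multiple:
  assumes J: "integral_form sc Y vac om UNIV J" and f: "f \<in> grade k"
  obtains m :: nat where "m > 0" "sc (of_nat m) f \<in> adjoint_stable J"
proof -
  obtain M where M: "\<And>j. j \<ge> M \<Longrightarrow> (L1 ^^ j) f = 0" using L1_nilpotent[OF f] by blast
  have add: "additive_subgroup J" using J by (simp add: integral_form_def)
  have "\<exists>m::nat. m > 0 \<and> sc (of_nat m) (sc (1 / fact j) ((L1 ^^ j) f)) \<in> J" for j
    using integral_form_multiple[OF J] by metis
  then obtain m where m: "\<And>j. m j > (0::nat)"
    "\<And>j. sc (of_nat (m j)) (sc (1 / fact j) ((L1 ^^ j) f)) \<in> J"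
    by metis
  define n where "n = (\<Prod>j<M. m j)"
  have "sc (1 / fact j) ((L1 ^^ j) (sc (of_nat n) f)) \<in> J" for j
  proof (cases "j < M")
    case True
    then have "n = (\<Prod>i\<in>{..<M} - {j}. m i) * m j"
      unfolding n_def by (subst prod.remove[of _ j]) auto
    then have "sc (1 / fact j) ((L1 ^^ j) (sc (of_nat n) f))
      = sc (of_int (int (\<Prod>i\<in>{..<M} - {j}. m i))) (sc (of_nat (m j)) (sc (1 / fact j) ((L1 ^^ j) f)))"
      by (simp add: L1_pow_scale mult_ac)
    then show ?thesis using additive_subgroup_scale_int[OF add m(2)] by metis
  next
    case False
    then show ?thesis using M[of j] add by (simp add: L1_pow_scale additive_subgroup_def)
  qed
  then have "sc (of_nat n) f \<in> adjoint_stable J"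
    using subspace_scale[OF subspace_grade f] unfolding adjoint_stable_def by blast
  then show thesis using that[of n] m(1) by (simp add: n_def prod_pos)
qed

lemma adjoint_stable_spanning:
  assumes J: "integral_form sc Y vac om UNIV J"
  shows "\<exists>H. finite H \<and> H \<subseteq> adjoint_stable J \<and> v \<in> span H"
proof -
  obtain S f where f: "finite S" "\<And>n. f n \<in> grade n" "v = (\<Sum>n\<in>S. f n)"
    using homogeneous_decomposition[of v] by blast
  have "\<exists>m::nat. m > 0 \<and> sc (of_nat m) (f n) \<in> adjoint_stable J" for n
    using adjoint_stable_multiple[OF J f(2)] by metis
  then obtain m where m: "\<And>n. m n > (0::nat)" "\<And>n. sc (of_nat (m n)) (f n) \<in> adjoint_stable J"
    by metis
  define H where "H = (\<lambda>n. sc (of_nat (m n)) (f n)) ` S"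
  have "f n \<in> span H" if "n \<in> S" for n
  proof -
    have "f n = sc (1 / of_nat (m n)) (sc (of_nat (m n)) (f n))" using m(1)[of n] by simp
    then show ?thesis using that by (metis H_def imageI span_base span_scale)
  qed
  then have "v \<in> span H" unfolding f(3) by (intro span_sum)
  then show ?thesis using f(1) m(2) by (intro exI[of _ H]) (auto simp: H_def)
qed

text \<open>Automorphisms preserve weights and commute with L(1).\<close>

lemma VOA_aut_adjoint_stable:
  assumes g: "VOA_aut sc Y vac om g" and J: "g ` J \<subseteq> J" and f: "f \<in> adjoint_stable J"
  shows "g f \<in> adjoint_stable J"
proof -
  have "sc (1 / fact j) ((L1 ^^ j) (g f)) \<in> J" for j
  proof -
    have "g (sc (1 / fact j) ((L1 ^^ j) f)) \<in> J" using f J unfolding adjoint_stable_def by blast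
    then show ?thesis using g VOA_aut_L1_pow[OF g, of j f] by (simp add: VOA_aut_def)
  qed
  then show ?thesis using f VOA_aut_grade[OF g] unfolding adjoint_stable_def by blast
qed

text \<open>The preimage of \<open>X\<close> under \<open>g\<close> is an additive subgroup closed
  under products. The target \<open>X\<close> is kept general: it serves both for the generated
  subring itself and for rational subalgebras.\<close>

lemma VOA_aut_generated_closure:
  assumes g: "VOA_aut sc Y vac om g" and X: "additive_subgroup X" "product_closed Y X"
    and F: "g ` F \<subseteq> X"
  shows "g ` generated_closure Y F \<subseteq> X"
proof -
  have add: "g (a + b) = g a + g b" for a b using g by (simp add: VOA_aut_def)
  then have "g 0 = 0" by (metis add_cancel_right_right)
  moreover from this add have "g (- a) = - g a" for a by (metis add_eq_0_iff)
  ultimately have "generated_closure Y F \<subseteq> {x. g x \<in> X}"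
    using F X g
    by (intro generated_closure_least)
       (auto simp: additive_subgroup_def product_closed_def VOA_aut_def)
  then show ?thesis by blast
qed

end

section \<open>The invariant form, adjoints and near lattice integrality\<close>

locale voa_form = voa sc Y vac om grade
  for sc :: "rat \<Rightarrow> 'v::ab_group_add \<Rightarrow> 'v" and Y vac om grade +
  fixes form :: "'v \<Rightarrow> 'v \<Rightarrow> rat"
  assumes natural: "natural_form sc Y vac om grade form"
begin

lemma form_add_left: "form (a + b) c = form a c + form b c"
  and form_add_right: "form a (b + c) = form a b + form a c"
  and form_scale_left: "form (sc q a) b = q * form a b"
  and form_scale_right: "form a (sc q b) = q * form a b"
  using natural by (auto simp: natural_form_def)

lemma form_zero_left: "form 0 c = 0" and form_zero_right: "form a 0 = 0"
  using form_scale_left[of 0 0 c] form_scale_right[of a 0 0] by auto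

lemma form_minus_left: "form (- a) c = - form a c" and form_minus_right: "form a (- c) = - form a c"
  using form_scale_left[of "-1" a c] form_scale_right[of a "-1" c] by auto

lemma form_invariant:
  assumes "a \<in> grade k" "\<And>j. j \<ge> M \<Longrightarrow> (L1 ^^ j) a = 0"
  shows "form (Y a n b) c = (if even k then 1 else -1) *
    (\<Sum>j<M. form b (Y ((L1 ^^ j) a) (2 * k - n - int j - 2) c) / fact j)"
  using natural assms unfolding natural_form_def by blast

text \<open>Since L(1) kills \<open>om\<close>, the adjoint formula makes L(0) self-adjoint. It has
  eigenvalue 0 on the vacuum and \<open>k\<close> on \<open>v\<close>, so the two are
  orthogonal.\<close>

lemma form_vac_homogeneous:
  assumes v: "v \<in> grade k" and k: "k \<noteq> 0"
  shows "form vac v = 0"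
proof -
  have "(L1 ^^ j) om = 0" if "j \<ge> 1" for j
    using that by (cases j) (simp_all add: funpow_Suc_right L1_om L1_pow_zero del: funpow.simps(2))
  then have "form (Y om 1 vac) v = form vac (Y om 1 v)"
    using form_invariant[OF om_grade, of 1 1 vac v] by simp
  then show ?thesis
    using k by (simp add: Y_vac_right_nonneg form_zero_left L0_grade[OF v] form_scale_right)
qed

text \<open>The factor \<open>1 / fact j\<close> of the adjoint formula is absorbed into the vector,
  where \<open>adjoint_stable\<close> controls it; \<open>q\<close> carries a common denominator
  along.\<close>

lemma adjoint_stable_form_Ints:
  fixes q :: rat
  assumes f: "f \<in> adjoint_stable J"
    and *: "\<And>j n. q * form b (Y (sc (1 / fact j) ((L1 ^^ j) f)) n c) \<in> \<int>"
  shows "q * form (Y f n b) c \<in> \<int>"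
proof -
  obtain k where k: "f \<in> grade k" using f unfolding adjoint_stable_def by blast
  obtain M where M: "\<And>j. j \<ge> M \<Longrightarrow> (L1 ^^ j) f = 0" using L1_nilpotent[OF k] by blast
  let ?s = "\<Sum>j<M. q * form b (Y (sc (1 / fact j) ((L1 ^^ j) f)) (2 * k - n - int j - 2) c)"
  have "q * form (Y f n b) c = (if even k then 1 else -1) * ?s"
    by (simp add: form_invariant[OF k M] Y_scale_left form_scale_right sum_distrib_left mult_ac)
  moreover have "?s \<in> \<int>" using * by (intro Ints_sum)
  ultimately show ?thesis by (cases "even k") auto
qed

text \<open>The operators \<open>Y f n\<close> for \<open>f \<in> F\<close> have adjoints that preserve the graded part \<open>Jgr\<close> of
  \<^term>\<open>J\<close>, so pairings of the subalgebra generated by \<^term>\<open>F\<close> with \<open>Jgr\<close> reduce to pairings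
  with the vacuum, which only see the lattice \<open>J \<inter> grade 0\<close> of finite rank.\<close>

lemma adjoint_stable_nearly_lattice_integral:
  assumes J: "integral_form sc Y vac om UNIV J" and F: "F \<subseteq> adjoint_stable J"
  shows "nearly_lattice_integral sc form (generated_closure Y F)"
proof -
  have addJ: "additive_subgroup J" and prodJ: "product_closed Y J"
    using J by (auto simp: integral_form_def)
  \<comment> \<open>Integral forms are not assumed to be graded, so \<open>J\<close> is replaced by
    the subring spanned by its homogeneous elements.\<close>
  define Jh where "Jh = {v \<in> J. \<exists>k. v \<in> grade k}"
  define Jgr where "Jgr = zspan sc Jh"
  have addJgr: "additive_subgroup Jgr" unfolding Jgr_def by (rule additive_subgroup_zspan)
  have prodJgr: "product_closed Y Jgr"
    unfolding Jgr_def
  proof (rule product_closed_zspan)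
    fix a b k assume "a \<in> Jh" "b \<in> Jh"
    then have "Y a k b \<in> Jh"
      using prodJ Y_grade unfolding Jh_def product_closed_def by blast
    then show "Y a k b \<in> zspan sc Jh" using zspan_base by blast
  qed
  have L1F: "sc (1 / fact j) ((L1 ^^ j) f) \<in> Jgr" if "f \<in> F" for f j
  proof -
    have "sc (1 / fact j) ((L1 ^^ j) f) \<in> Jh"
      using that F L1_pow_grade subspace_scale[OF subspace_grade]
      unfolding Jh_def adjoint_stable_def by blast
    then show ?thesis using zspan_base unfolding Jgr_def by blast
  qed
  have FJgr: "F \<subseteq> Jgr"
  proof
    fix f assume "f \<in> F"
    from L1F[OF this, of 0] show "f \<in> Jgr" by simp
  qed
  obtain B0 where B0: "finite B0" "grade 0 \<subseteq> span B0" using grade_finite_dim by blast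
  obtain C where C: "finite C" "J \<inter> grade 0 = zspan sc C"
    by (rule integral_form_intersect_finite_dim[OF J subspace_grade B0(2,1)])
  \<comment> \<open>\<open>m\<close> is a common denominator for the pairings of the vacuum with the
    finite set \<open>C\<close> spanning the weight 0 lattice.\<close>
  obtain m :: nat where m: "m > 0" "\<And>c. c \<in> C \<Longrightarrow> of_nat m * form vac c \<in> \<int>"
    by (rule finite_common_multiple_Ints[OF finite_imageI[OF C(1), of "form vac"]]) auto
  have vac_add: "additive_subgroup {v. of_nat m * form vac v \<in> \<int>}"
    by (auto simp: additive_subgroup_def form_zero_right form_add_right form_minus_right
        distrib_left)
  have vacJgr: "of_nat m * form vac v \<in> \<int>" if "v \<in> Jgr" for v
  proof -
    have "zspan sc C \<subseteq> {v. of_nat m * form vac v \<in> \<int>}"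
      by (intro zspan_least vac_add) (use m in auto)
    then have "Jh \<subseteq> {v. of_nat m * form vac v \<in> \<int>}"
      unfolding C(2)[symmetric] Jh_def using form_vac_homogeneous by fastforce
    from zspan_least[OF this vac_add] show ?thesis using that unfolding Jgr_def by blast
  qed
  \<comment> \<open>\<open>H\<close> consists of the elements whose pairings with \<open>Jgr\<close>
    have denominator dividing \<open>m\<close>, and \<open>S\<close> of those whose operators
    preserve \<open>H\<close>. By the Borcherds identity \<open>S\<close> is a subring, so it
    contains the whole generated subring once it contains \<open>F\<close>.\<close>
  define H where "H = {h \<in> Jgr. \<forall>b\<in>Jgr. of_nat m * form h b \<in> \<int>}"
  define S where "S = {x \<in> Jgr. \<forall>h\<in>H. \<forall>n. Y x n h \<in> H}"
  have addH: "additive_subgroup H"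
    using addJgr unfolding H_def
    by (auto simp: additive_subgroup_def form_zero_left form_add_left form_minus_left distrib_left)
  have addS: "additive_subgroup S"
    using addJgr addH unfolding S_def
    by (auto simp: additive_subgroup_def Y_zero_left Y_add_left Y_minus_left)
  have prodS: "product_closed Y S"
    using prodJgr iterate_preserves_subgroup[OF addH] unfolding S_def product_closed_def by blast
  have "F \<subseteq> S"
  proof
    fix f assume f: "f \<in> F"
    have "Y f n h \<in> H" if h: "h \<in> H" for h n
    proof -
      have "of_nat m * form (Y f n h) b \<in> \<int>" if b: "b \<in> Jgr" for b
      proof (rule adjoint_stable_form_Ints)
        show "f \<in> adjoint_stable J" using f F by blast
        show "of_nat m * form h (Y (sc (1 / fact j) ((L1 ^^ j) f)) n b) \<in> \<int>" for j n
          using h b L1F[OF f, of j] prodJgr unfolding H_def product_closed_def by blast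
      qed
      moreover have "Y f n h \<in> Jgr"
        using f h FJgr prodJgr unfolding H_def product_closed_def by blast
      ultimately show ?thesis by (simp add: H_def)
    qed
    then show "f \<in> S" using f FJgr unfolding S_def by blast
  qed
  then have S: "generated_closure Y F \<subseteq> S" using addS prodS by (rule generated_closure_least)
  obtain m0 :: nat where m0: "m0 > 0" "sc (of_nat m0) vac \<in> J"
    using J unfolding integral_form_def by blast
  have "sc (of_nat m0) vac \<in> Jgr"
    using m0(2) subspace_scale[OF subspace_grade vac_grade] zspan_base[of Jh]
    unfolding Jgr_def Jh_def by blast
  moreover have "of_nat m * form (sc (of_nat m0) vac) b \<in> \<int>" if "b \<in> Jgr" for b
    using vacJgr[OF that] by (simp add: form_scale_left mult.left_commute)
  ultimately have vacH: "sc (of_nat m0) vac \<in> H" by (simp add: H_def)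
  have *: "of_nat m * (of_nat m0 * form x y) \<in> \<int>"
    if "x \<in> generated_closure Y F" "y \<in> generated_closure Y F" for x y
  proof -
    \<comment> \<open>As \<open>x\<close> is the product \<open>Y x (-1) vac\<close>, applying
      \<open>x\<close> to the vacuum multiple in \<open>H\<close> puts
      \<open>sc (of_nat m0) x\<close> into \<open>H\<close>.\<close>
    have "Y x (-1) (sc (of_nat m0) vac) \<in> H" using that(1) S vacH unfolding S_def by blast
    then have "sc (of_nat m0) x \<in> H" by (simp add: Y_scale_right Y_vac_right)
    then show ?thesis using that(2) S unfolding S_def H_def by (auto simp: form_scale_left)
  qed
  have "lattice_integral form (sc (of_nat (m * m0)) ` generated_closure Y F)"
    unfolding lattice_integral_def
  proof clarify
    fix x y assume xy: "x \<in> generated_closure Y F" "y \<in> generated_closure Y F"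
    have "form (sc (of_nat (m * m0)) x) (sc (of_nat (m * m0)) y)
        = of_nat (m * m0) * (of_nat m * (of_nat m0 * form x y))"
      by (simp add: form_scale_left form_scale_right mult_ac)
    also have "\<dots> \<in> \<int>" by (rule Ints_mult[OF Ints_of_nat *[OF xy]])
    finally show "form (sc (of_nat (m * m0)) x) (sc (of_nat (m * m0)) y) \<in> \<int>" .
  qed
  then show ?thesis unfolding nearly_lattice_integral_def
    using m(1) m0(1) by (intro exI[of _ "m * m0"]) simp
qed

text \<open>The hypothesis \<open>T_gen\<close> says that the finite set \<open>T\<close> generates
  \<open>V\<close> as a rational algebra. The group argument enters only through it; everything else
  takes place inside \<open>J\<close>.\<close>

lemma finitely_generated_subform_exists:
  assumes T: "finite T"
    and T_gen: "\<And>U. subspace U \<Longrightarrow> product_closed Y U \<Longrightarrow> T \<subseteq> U \<Longrightarrow> U = UNIV"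
    and G: "finite_aut_group sc Y vac om G"
    and J: "integral_form sc Y vac om UNIV J" and GJ: "\<forall>g\<in>G. g ` J \<subseteq> J"
  shows "\<exists>J'. J' \<subseteq> J \<and> integral_form sc Y vac om UNIV J' \<and>
    finitely_generated Y J' \<and> nearly_lattice_integral sc form J' \<and>
    (\<forall>g\<in>G. g ` J' \<subseteq> J') \<and>
    J' \<inter> range (\<lambda>q. sc q vac) = J \<inter> range (\<lambda>q. sc q vac) \<and>
    J' \<inter> range (\<lambda>q. sc q om) = J \<inter> range (\<lambda>q. sc q om)"
proof -
  have addJ: "additive_subgroup J" and prodJ: "product_closed Y J"
    using J by (auto simp: integral_form_def)
  have G_fin: "finite G" and G_id: "id \<in> G"
    and G_comp: "\<And>g h. g \<in> G \<Longrightarrow> h \<in> G \<Longrightarrow> g \<circ> h \<in> G"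
    and G_aut: "\<And>g. g \<in> G \<Longrightarrow> VOA_aut sc Y vac om g"
    using G unfolding finite_aut_group_def is_subgroup_def by auto
  have line: "\<exists>C. finite C \<and> J \<inter> range (\<lambda>q. sc q x) = zspan sc C" for x
  proof -
    have "range (\<lambda>q. sc q x) = span {x}" by (auto simp: span_singleton)
    moreover obtain C where "finite C" "J \<inter> span {x} = zspan sc C"
      by (rule integral_form_intersect_finite_dim[OF J subspace_span order_refl, of "{x}"]) auto
    ultimately show ?thesis by auto
  qed
  obtain Cv Co where Cv: "finite Cv" "J \<inter> range (\<lambda>q. sc q vac) = zspan sc Cv"
    and Co: "finite Co" "J \<inter> range (\<lambda>q. sc q om) = zspan sc Co"
    using line by metis
  \<comment> \<open>Homogeneous vectors killed by L(1), such as multiples of \<open>vac\<close> and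
    \<open>om\<close>, lie in \<open>adjoint_stable J\<close> as soon as they lie in
    \<open>J\<close>.\<close>
  have line_stable: "C \<subseteq> adjoint_stable J"
    if C: "J \<inter> range (\<lambda>q. sc q x) = zspan sc C" and x: "x \<in> grade k" "L1 x = 0" for C x k
  proof
    fix c assume "c \<in> C"
    then obtain q where "c \<in> J" "c = sc q x" using C zspan_base[of C] by blast
    then show "c \<in> adjoint_stable J"
      using x addJ subspace_scale[OF subspace_grade x(1)]
      by (intro adjoint_stable_if_L1_zero[of _ _ k]) (auto simp: Y_scale_right additive_subgroup_def)
  qed
  obtain Hs where Hs: "\<And>v. finite (Hs v)" "\<And>v. Hs v \<subseteq> adjoint_stable J" "\<And>v. v \<in> span (Hs v)"
    using adjoint_stable_spanning[OF J] by metis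
  \<comment> \<open>The sets \<open>Hs v\<close> make the rational span everything, while
    \<open>Cv\<close> and \<open>Co\<close> force the intersections with the two lines to agree with
    those of \<open>J\<close>.\<close>
  define F1 where "F1 = (\<Union>v\<in>T. Hs v) \<union> Cv \<union> Co"
  define F where "F = (\<Union>g\<in>G. g ` F1)"
  define J' where "J' = generated_closure Y F"
  have F1_stable: "F1 \<subseteq> adjoint_stable J"
    unfolding F1_def using Hs(2) line_stable[OF Cv(2) vac_grade L1_vac]
      line_stable[OF Co(2) om_grade L1_om] by blast
  have F_stable: "F \<subseteq> adjoint_stable J"
    unfolding F_def using F1_stable VOA_aut_adjoint_stable G_aut GJ by blast
  have "finite F" unfolding F_def F1_def using T Hs(1) Cv(1) Co(1) G_fin by blast
  then have fg: "finitely_generated Y J'" unfolding finitely_generated_def J'_def by blast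
  have nli: "nearly_lattice_integral sc form J'"
    unfolding J'_def by (rule adjoint_stable_nearly_lattice_integral[OF J F_stable])
  have addJ': "additive_subgroup J'" and prodJ': "product_closed Y J'" and FJ': "F \<subseteq> J'"
    unfolding J'_def by (rule additive_subgroup_generated_closure product_closed_generated_closure
        generated_closure_superset)+
  have J'J: "J' \<subseteq> J" unfolding J'_def
    using F_stable adjoint_stable_subset addJ prodJ by (intro generated_closure_least) auto
  have F1_F: "F1 \<subseteq> F" unfolding F_def using UN_upper[OF G_id, of "\<lambda>g. g ` F1"] by simp
  have inv: "g ` J' \<subseteq> J'" if g: "g \<in> G" for g
  proof -
    have "g ` F \<subseteq> F"
    proof
      fix y assume "y \<in> g ` F"
      then obtain h x where "h \<in> G" "x \<in> F1" "y = (g \<circ> h) x" unfolding F_def by auto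
      then show "y \<in> F" using G_comp[OF g] unfolding F_def by blast
    qed
    then show ?thesis
      using VOA_aut_generated_closure[OF G_aut[OF g] addJ' prodJ', of F] FJ' J'_def by blast
  qed
  have lines: "J' \<inter> R = J \<inter> R" if "J \<inter> R = zspan sc C" "C \<subseteq> F1" for R C
  proof -
    have "zspan sc C \<subseteq> J'" using that(2) F1_F FJ' addJ' by (intro zspan_least) auto
    then show ?thesis using that(1) J'J by blast
  qed
  have vac_eq: "J' \<inter> range (\<lambda>q. sc q vac) = J \<inter> range (\<lambda>q. sc q vac)"
    and om_eq: "J' \<inter> range (\<lambda>q. sc q om) = J \<inter> range (\<lambda>q. sc q om)"
    using lines[OF Cv(2)] lines[OF Co(2)] unfolding F1_def by auto
  have "T \<subseteq> span J'"
  proof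
    fix v assume "v \<in> T"
    then have "Hs v \<subseteq> J'" using F1_F FJ' unfolding F1_def by blast
    then show "v \<in> span J'" using Hs(3)[of v] span_mono by blast
  qed
  then have spanJ': "span J' = UNIV"
    using T_gen[of "span J'"] product_closed_span[OF prodJ'] by simp
  \<comment> \<open>As a subgroup of the free group \<open>J\<close>, \<open>J'\<close> has a basis
    that is independent over the rationals; it spans because \<open>J'\<close> does.\<close>
  obtain B where B: "independent B" "J = zspan sc B" using J unfolding integral_form_def by blast
  obtain B' where B': "independent B'" "J' = zspan sc B'"
    by (rule subgroup_of_free_is_free[OF B(1) addJ']) (use J'J B(2) in auto)
  have "span B' = UNIV" using spanJ' B'(2) span_zspan by simp
  moreover have "\<exists>m::nat. m > 0 \<and> sc (of_nat m) vac \<in> J'"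
    using J vac_eq unfolding integral_form_def by blast
  moreover have "\<exists>m::nat. m > 0 \<and> sc (of_nat m) om \<in> J'"
    using J om_eq unfolding integral_form_def by blast
  ultimately have "integral_form sc Y vac om UNIV J'"
    using B' addJ' prodJ' unfolding integral_form_def by blast
  then show ?thesis using J'J fg nli inv vac_eq om_eq by blast
qed

end

section \<open>Elementary abelian 2-groups, their characters and their joint eigenvectors\<close>

lemma iso_Z2_power_involutive:
  assumes iso: "iso_Z2_power E r" and id: "id \<in> E"
    and comp: "\<And>e e'. e \<in> E \<Longrightarrow> e' \<in> E \<Longrightarrow> e \<circ> e' \<in> E"
    and e: "e \<in> E"
  shows "e \<circ> e = id"
proof -
  obtain \<phi> where bij: "bij_betw \<phi> E {f :: nat \<Rightarrow> bool. \<forall>i\<ge>r. \<not> f i}"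
    and hom: "\<forall>e\<in>E. \<forall>e'\<in>E. \<phi> (e \<circ> e') = (\<lambda>i. \<phi> e i \<noteq> \<phi> e' i)"
    using iso unfolding iso_Z2_power_def by (elim exE conjE)
  note hom = hom[rule_format] and inj = bij_betw_imp_inj_on[OF bij]
  have "\<phi> (id \<circ> id) = (\<lambda>i. False)" by (subst hom[OF id id]) simp
  moreover have "\<phi> (e \<circ> e) = (\<lambda>i. False)" by (subst hom[OF e e]) simp
  ultimately show ?thesis using inj id comp[OF e e] by (metis comp_id inj_onD)
qed

locale involution_group =
  fixes E :: "('v \<Rightarrow> 'v) set"
  assumes finite: "finite E" and id: "id \<in> E"
    and comp: "\<And>e f. e \<in> E \<Longrightarrow> f \<in> E \<Longrightarrow> e \<circ> f \<in> E"
    and involutive: "\<And>e. e \<in> E \<Longrightarrow> e \<circ> e = id"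
begin

lemma involutive_apply: "e \<in> E \<Longrightarrow> e (e v) = v"
  using involutive by (metis comp_apply id_apply)

text \<open>The product of \<open>e\<close> and \<open>f\<close> is again an involution, which
  forces them to commute.\<close>

lemma commute_apply:
  assumes "e \<in> E" "f \<in> E"
  shows "e (f v) = f (e v)"
  using involutive_apply[OF comp[OF assms], of "f (e v)"] involutive_apply assms
  by (metis comp_apply)

text \<open>A maximal proper subgroup containing \<^term>\<open>D\<close> has index two, since all elements are
  involutions.\<close>

lemma separating_character:
  assumes D: "is_subgroup D E" and ne: "D \<noteq> E"
  obtains \<chi> :: "('v \<Rightarrow> 'v) \<Rightarrow> complex" where "nontrivial_char E \<chi>" "\<forall>d\<in>D. \<chi> d = 1"
proof -
  \<comment> \<open>The identity is inherited from \<open>D\<close> and every element is its own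
    inverse, so closure under composition describes proper subgroups containing
    \<open>D\<close>.\<close>
  define P where
    "P M \<longleftrightarrow> D \<subseteq> M \<and> M \<subseteq> E \<and> M \<noteq> E \<and> (\<forall>g\<in>M. \<forall>h\<in>M. g \<circ> h \<in> M)" for M
  have "P D" using D ne by (auto simp: P_def is_subgroup_def)
  have "finite {M. P M}"
    by (rule finite_subset[OF _ finite_Pow_iff[THEN iffD2, OF finite]]) (auto simp: P_def)
  then obtain M where "P M" and max: "\<And>M'. P M' \<Longrightarrow> M \<subseteq> M' \<Longrightarrow> M' = M"
    using finite_has_maximal[of "{M. P M}"] \<open>P D\<close> by auto
  then have M: "D \<subseteq> M" "M \<subseteq> E" "M \<noteq> E" "\<And>g h. g \<in> M \<Longrightarrow> h \<in> M \<Longrightarrow> g \<circ> h \<in> M"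
    unfolding P_def by auto
  have idM: "id \<in> M" using D M(1) by (auto simp: is_subgroup_def)
  have com: "e \<circ> f = f \<circ> e" if "e \<in> E" "f \<in> E" for e f
    using commute_apply[OF that] by auto
  have cancel: "e \<circ> (e \<circ> f) = f" if "e \<in> E" for e f
    using involutive[OF that] by (metis comp_assoc id_comp)
  have out: "e \<circ> f \<in> M" if e: "e \<in> E" "e \<notin> M" and f: "f \<in> E" "f \<notin> M" for e f
  proof -
    \<comment> \<open>\<open>M'\<close> is a subgroup strictly larger than \<open>M\<close>, so it
      is all of \<open>E\<close> by maximality. Hence \<open>f\<close> lies in the coset of
      \<open>e\<close>, and composing with \<open>e\<close> brings it back into
      \<open>M\<close>.\<close>
    define M' where "M' = M \<union> (\<lambda>g. e \<circ> g) ` M"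
    have "e = e \<circ> id" by simp
    then have "e \<in> M'" using idM unfolding M'_def by blast
    have closed: "g \<circ> h \<in> M'" if gh: "g \<in> M'" "h \<in> M'" for g h
    proof -
      obtain g' where g': "g' \<in> M" "g = g' \<or> g = e \<circ> g'" using gh(1) unfolding M'_def by blast
      obtain h' where h': "h' \<in> M" "h = h' \<or> h = e \<circ> h'" using gh(2) unfolding M'_def by blast
      have "g' \<circ> h' \<in> M" using M(4) g' h' by blast
      moreover have "g' \<circ> (e \<circ> h') = e \<circ> (g' \<circ> h')"
        using com[OF e(1), of g'] g'(1) M(2) by (metis comp_assoc subsetD)
      moreover have "(e \<circ> g') \<circ> (e \<circ> h') = g' \<circ> h'"
        using calculation(2) cancel[OF e(1)] by (metis comp_assoc)
      ultimately show ?thesis using g'(2) h'(2) unfolding M'_def by (metis comp_assoc UnI1 UnI2 imageI)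
    qed
    have "M' \<subseteq> E" using M(2) comp e(1) unfolding M'_def by blast
    moreover have "M \<subseteq> M'" "M' \<noteq> M" using \<open>e \<in> M'\<close> e(2) unfolding M'_def by auto
    ultimately have "M' = E" using max[of M'] closed M(1) unfolding P_def by blast
    then obtain g where "g \<in> M" "f = e \<circ> g" using f unfolding M'_def by blast
    then show ?thesis using cancel[OF e(1)] by metis
  qed
  have mixed: "e \<circ> f \<notin> M" if "e \<in> M" "f \<in> E" "f \<notin> M" for e f
    using that M(2,4) cancel by (metis subsetD)
  have mixed': "f \<circ> e \<notin> M" if "e \<in> M" "f \<in> E" "f \<notin> M" for e f
    using mixed[OF that] com[of e f] that(1,2) M(2) by auto
  \<comment> \<open>Index two makes the sign function with kernel \<open>M\<close>
    multiplicative.\<close>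
  define \<chi> :: "('v \<Rightarrow> 'v) \<Rightarrow> complex" where "\<chi> e = (if e \<in> M then 1 else -1)" for e
  have "\<chi> (e \<circ> f) = \<chi> e * \<chi> f" if "e \<in> E" "f \<in> E" for e f
    using that out mixed mixed' M(4) by (auto simp: \<chi>_def)
  then have "linear_char E \<chi>" unfolding linear_char_def by (auto simp: \<chi>_def)
  moreover have "\<exists>e\<in>E. \<chi> e \<noteq> 1" using M(2,3) by (auto simp: \<chi>_def)
  ultimately have "nontrivial_char E \<chi>" unfolding nontrivial_char_def by blast
  moreover have "\<forall>d\<in>D. \<chi> d = 1" using M(1) by (auto simp: \<chi>_def)
  ultimately show thesis by (rule that)
qed

end

text \<open>Diagonalise one involution at a time: \<open>u\<close> is half the sum of
  \<open>u + e u\<close> and \<open>u - e u\<close>. Commutativity keeps both parts eigenvectors of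
  the involutions already treated.\<close>

lemma (in rat_vector_space) span_joint_eigenvectors:
  assumes E: "involution_group E"
    and lin: "\<And>e a b. e \<in> E \<Longrightarrow> e (a + b) = e a + e b"
      "\<And>e q a. e \<in> E \<Longrightarrow> e (sc q a) = sc q (e a)"
  shows "v \<in> span {u. \<forall>e\<in>E. e u = u \<or> e u = - u}"
proof -
  interpret involution_group E by (rule E)
  have neg: "e (- a) = - e a" if "e \<in> E" for e a
    using lin(2)[OF that, of "-1" a] by simp
  have "finite S \<Longrightarrow> S \<subseteq> E \<Longrightarrow> v \<in> span {u. \<forall>e\<in>S. e u = u \<or> e u = - u}" for S v
  proof (induction S arbitrary: v rule: finite_induct)
    case empty
    then show ?case by (simp add: span_base)
  next
    case (insert e S)
    let ?U = "{u. \<forall>e\<in>S. e u = u \<or> e u = - u}" and ?U' = "{u. \<forall>e\<in>insert e S. e u = u \<or> e u = - u}"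
    have e: "e \<in> E" using insert by blast
    have "?U \<subseteq> span ?U'"
    proof
      fix u assume u: "u \<in> ?U"
      have eig: "f (u + e u) = u + e u \<or> f (u + e u) = - (u + e u)"
          "f (u - e u) = u - e u \<or> f (u - e u) = - (u - e u)" if f: "f \<in> S" for f
      proof -
        have fE: "f \<in> E" using insert f by blast
        have "f u = u \<or> f u = - u" using u f by blast
        moreover have "f (e u) = e (f u)" using commute_apply[OF fE e] .
        moreover have "f (u - e u) = f u - f (e u)"
          using lin(1)[OF fE, of u "- e u"] neg[OF fE] by simp
        ultimately show "f (u + e u) = u + e u \<or> f (u + e u) = - (u + e u)"
          "f (u - e u) = u - e u \<or> f (u - e u) = - (u - e u)"
          using lin(1)[OF fE, of u "e u"] neg[OF e] by auto
      qed
      have "e (u + e u) = u + e u"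
        using lin(1)[OF e, of u "e u"] involutive_apply[OF e] by (simp add: add.commute)
      moreover have "e (u - e u) = - (u - e u)"
        using lin(1)[OF e, of u "- e u"] involutive_apply[OF e] neg[OF e] by simp
      ultimately have "u + e u \<in> ?U'" "u - e u \<in> ?U'" using eig by auto
      then have "sc (1/2) ((u + e u) + (u - e u)) \<in> span ?U'"
        by (intro span_scale span_add span_base)
      moreover have "(u + e u) + (u - e u) = sc 2 u"
        using scale_left_distrib[of 1 1 u] by simp
      ultimately show "u \<in> span ?U'" by simp
    qed
    then have "span ?U \<subseteq> span ?U'" by (simp add: span_minimal)
    then show ?case using insert.IH[of v] insert.prems by blast
  qed
  from this[OF finite order_refl] show ?thesis .
qed

text \<open>A joint eigenvector of \<open>E\<close> carries a sign character. If it is trivial, the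
  vector is already fixed by \<open>D\<close>; otherwise some \<open>g\<close> in \<open>N\<close>
  carries a character trivial on \<open>D\<close> to it, and \<open>inv g\<close> moves the vector
  into the fixed points of \<open>D\<close>.\<close>

lemma (in rat_vector_space) translates_of_fixed_points_span:
  assumes E: "involution_group E" and EN: "normal_subgroup E N"
    and bij: "\<And>g. g \<in> N \<Longrightarrow> bij g"
    and lin: "\<And>g a b. g \<in> N \<Longrightarrow> g (a + b) = g a + g b"
      "\<And>g q a. g \<in> N \<Longrightarrow> g (sc q a) = sc q (g a)"
    and trans: "transitive_on_nontrivial_chars N E"
    and D: "is_subgroup D E" "D \<noteq> E"
  shows "span (\<Union>g\<in>N. g ` fixed_points D) = UNIV"
proof -
  interpret involution_group E by (rule E)
  have EN': "E \<subseteq> N" and conj: "\<And>g e. g \<in> N \<Longrightarrow> e \<in> E \<Longrightarrow> g \<circ> e \<circ> inv g \<in> E"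
    using EN unfolding normal_subgroup_def is_subgroup_def by auto
  have DE: "D \<subseteq> E" using D unfolding is_subgroup_def by blast
  obtain \<chi>0 :: "('v \<Rightarrow> 'v) \<Rightarrow> complex"
    where \<chi>0: "nontrivial_char E \<chi>0" "\<forall>d\<in>D. \<chi>0 d = 1"
    by (rule separating_character[OF D])
  let ?U = "{u. \<forall>e\<in>E. e u = u \<or> e u = - u}"
  have "u \<in> (\<Union>g\<in>N. g ` fixed_points D)" if u: "u \<in> ?U" for u
  proof (cases "\<forall>e\<in>E. e u = u")
    case True
    then have "u \<in> id ` fixed_points D" using DE by (auto simp: fixed_points_def)
    then show ?thesis by (rule UN_I[OF subsetD[OF EN' id]])
  next
    case False
    \<comment> \<open>The two signs are distinguishable on \<open>u\<close>, which makes
      \<open>\<chi>\<close> below multiplicative.\<close>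
    then have u0: "u \<noteq> - u" using u by auto
    have neg: "e (- u) = - e u" if "e \<in> E" for e
      using lin(2)[of e "-1" u] that EN' by auto
    define \<chi> :: "('v \<Rightarrow> 'v) \<Rightarrow> complex" where "\<chi> e = (if e u = u then 1 else -1)" for e
    have "\<chi> (e \<circ> f) = \<chi> e * \<chi> f" if "e \<in> E" "f \<in> E" for e f
    proof -
      have "e u = u \<or> e u = - u" "f u = u \<or> f u = - u" using u that by auto
      then show ?thesis using neg[OF that(1)] u0 by (auto simp: \<chi>_def)
    qed
    then have "nontrivial_char E \<chi>"
      using False unfolding nontrivial_char_def linear_char_def by (auto simp: \<chi>_def)
    then obtain g where g: "g \<in> N" "\<forall>e\<in>E. \<chi> e = \<chi>0 (inv g \<circ> e \<circ> g)"
      using trans \<chi>0(1) unfolding transitive_on_nontrivial_chars_def by blast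
    have gi: "inv g (g x) = x" "g (inv g x) = x" for x
      using bij[OF g(1)] by (simp_all add: bij_is_inj bij_is_surj surj_f_inv_f)
    have "d (inv g u) = inv g u" if d: "d \<in> D" for d
    proof -
      \<comment> \<open>The conjugate of \<open>d\<close> by \<open>g\<close> has
        \<open>\<chi>\<close>-value \<open>\<chi>0 d = 1\<close>, so it fixes \<open>u\<close>;
        equivalently \<open>d\<close> fixes \<open>inv g u\<close>.\<close>
      have "inv g \<circ> (g \<circ> d \<circ> inv g) \<circ> g = d" using gi by auto
      then have "\<chi> (g \<circ> d \<circ> inv g) = 1"
        using g(2) conj[OF g(1), of d] d DE \<chi>0(2) by auto
      then have "g (d (inv g u)) = u" by (auto simp: \<chi>_def split: if_splits)
      then show ?thesis using gi by metis
    qed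
    then have "inv g u \<in> fixed_points D" by (simp add: fixed_points_def)
    then show ?thesis using g(1) gi(2)[of u] by (intro UN_I[of g]) (metis imageI)+
  qed
  then have "span ?U \<subseteq> span (\<Union>g\<in>N. g ` fixed_points D)" by (intro span_mono) blast
  moreover have "v \<in> span ?U" for v
    by (rule span_joint_eigenvectors[OF E]) (use lin EN' in auto)
  ultimately show ?thesis by blast
qed

section \<open>Generating \<open>V\<close> by the translates of the generators of
  \<open>K\<close>\<close>

theorem theorem2p8:
  fixes sc :: "rat \<Rightarrow> 'v::ab_group_add \<Rightarrow> 'v"
    and Y :: "'v \<Rightarrow> int \<Rightarrow> 'v \<Rightarrow> 'v"
    and vac om :: 'v
    and grade :: "int \<Rightarrow> 'v set"
    and form :: "'v \<Rightarrow> 'v \<Rightarrow> rat"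
    and N E D :: "('v \<Rightarrow> 'v) set"
    and r :: nat
    and K :: "'v set"
  assumes VOA: "is_VOA sc Y vac om grade"
    and form: "natural_form sc Y vac om grade form"
    and N: "finite_aut_group sc Y vac om N"
    and E_normal: "normal_subgroup E N"
    and E_iso: "iso_Z2_power E r"
    and r: "r \<ge> 2"
    and trans: "transitive_on_nontrivial_chars N E"
    and D: "is_subgroup D E"
    and rank: "D \<noteq> E"
    and K_IF: "integral_form sc Y vac om (fixed_points D) K"
    and K_fg: "finitely_generated Y K"
    and K_nli: "nearly_lattice_integral sc form K"
  shows "(\<forall>J. integral_form sc Y vac om UNIV J \<longrightarrow>
            (\<exists>J'. J' \<subseteq> J \<and> integral_form sc Y vac om UNIV J' \<and>
                  finitely_generated Y J' \<and> nearly_lattice_integral sc form J'))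
       \<and> (\<forall>G J. finite_aut_group sc Y vac om G \<longrightarrow> integral_form sc Y vac om UNIV J \<longrightarrow>
            (\<forall>g\<in>G. g ` J \<subseteq> J) \<longrightarrow>
            (\<exists>J'. J' \<subseteq> J \<and> integral_form sc Y vac om UNIV J' \<and>
                  finitely_generated Y J' \<and> nearly_lattice_integral sc form J' \<and>
                  (\<forall>g\<in>G. g ` J' \<subseteq> J') \<and>
                  J' \<inter> range (\<lambda>q. sc q vac) = J \<inter> range (\<lambda>q. sc q vac) \<and>
                  J' \<inter> range (\<lambda>q. sc q om) = J \<inter> range (\<lambda>q. sc q om)))"
proof -
  interpret voa_form sc Y vac om grade form
    using VOA form by unfold_locales
  have N_fin: "finite N"
    and N_aut: "\<And>g. g \<in> N \<Longrightarrow> VOA_aut sc Y vac om g"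
    using N unfolding finite_aut_group_def is_subgroup_def by auto
  have E_sub: "E \<subseteq> N" "id \<in> E" "\<And>e f. e \<in> E \<Longrightarrow> f \<in> E \<Longrightarrow> e \<circ> f \<in> E"
    using E_normal unfolding normal_subgroup_def is_subgroup_def by auto
  have E: "involution_group E"
    using E_sub N_fin finite_subset iso_Z2_power_involutive[OF E_iso E_sub(2,3)]
    by unfold_locales auto
  have span_W: "span (\<Union>g\<in>N. g ` fixed_points D) = UNIV"
    using N_aut
    by (intro translates_of_fixed_points_span[OF E E_normal _ _ _ trans D rank])
       (auto simp: VOA_aut_def)
  obtain FK where FK: "finite FK" "K = generated_closure Y FK"
    using K_fg unfolding finitely_generated_def by blast
  have span_K: "span K = fixed_points D"
    using K_IF span_zspan unfolding integral_form_def by blast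
  define T where "T = (\<Union>g\<in>N. g ` FK)"
  have T_fin: "finite T" unfolding T_def using N_fin FK(1) by blast
  \<comment> \<open>A rational subalgebra containing \<open>T\<close> contains every
    \<open>g\<close> image of \<open>K\<close>, hence of its span \<open>fixed_points D\<close>, and
    these images span \<open>V\<close>.\<close>
  have T_gen: "U = UNIV" if U: "subspace U" "product_closed Y U" "T \<subseteq> U" for U
  proof -
    have "g ` fixed_points D \<subseteq> U" if g: "g \<in> N" for g
    proof -
      have "g ` K \<subseteq> U"
        unfolding FK(2) using U g
        by (intro VOA_aut_generated_closure N_aut subspace_imp_additive_subgroup) (auto simp: T_def)
      moreover have g0: "g 0 = 0" using N_aut[OF g] by (metis VOA_aut_def scale_zero_left)
      ultimately have "span K \<subseteq> {x. g x \<in> U}"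
        using U(1) N_aut[OF g] g0
        by (intro span_minimal) (auto simp: subspace_def VOA_aut_def)
      then show ?thesis unfolding span_K by blast
    qed
    then have "span (\<Union>g\<in>N. g ` fixed_points D) \<subseteq> U" using U(1) by (intro span_minimal) auto
    then show ?thesis using span_W by blast
  qed
  note subform = finitely_generated_subform_exists[OF T_fin T_gen, rotated 3]
  show ?thesis
  proof (intro conjI allI impI)
    fix J assume J: "integral_form sc Y vac om UNIV J"
    \<comment> \<open>The first claim is the case of the trivial group.\<close>
    have "finite_aut_group sc Y vac om {id}"
      by (auto simp: finite_aut_group_def is_subgroup_def VOA_aut_def)
    from subform[OF this J] show "\<exists>J'. J' \<subseteq> J \<and> integral_form sc Y vac om UNIV J' \<and>
        finitely_generated Y J' \<and> nearly_lattice_integral sc form J'"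
      by auto
  qed (rule subform)
qed

end
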